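(* Let $R$, $Q_R$ be as in the context, let $q\in Q_R$ (in particular $\mathrm{Sc}\,q>1$), and let $$\mathcal H:=\Big\{f=\sum_{k\in\mathbb{Z}}a_kB_q(\cdot-k):\ a_k\in\mathbb{H}_\mathbb{C},\ \sum_k|a_k|^2<\infty\Big\}.$$ Then for every $f\in\mathcal H$, $$f(t)=\lim_{N\to\infty}\sum_{k=-N}^Nf(k)\,L_q(t-k),$$ where the convergence holds in the $L^2(\mathbb{R},\mathbb{H}_\mathbb{C})$ norm, pointwise, and uniformly on compact subsets of $\mathbb{R}$.
   Context: $\mathbb{H}_\mathbb{R}$ denotes the real quaternions $a+v_1e_1+v_2e_2+v_3e_3$ with $e_1^2=e_2^2=e_3^2=-1$, $e_1e_2=e_3$, $e_2e_3=e_1$, $e_3e_1=e_2$; $\mathbb{H}_\mathbb{C}$ the complex quaternions (complex coefficients, $i$ commuting with every $e_j$), $|q_0+\sum q_je_j|=(\sum|q_j|^2)^{1/2}$. For $q=a+v$, $v=\sum v_je_j$, $|v|=(\sum v_j^2)^{1/2}$. Quaternionic power: for $z\in\mathbb{C}\setminus\{0\}$, $z^q:=z^a[\cos(|v|\log z)+\frac{v}{|v|}\sin(|v|\log z)]$ (principal $\log$). $\Xi(\xi):=\frac{1-e^{-i\xi}}{i\xi}$, $\Xi(0):=1$; $\widehat{B_q}:=\Xi^q$ and $B_q$ is its inverse Fourier transform ($\hat f(\xi)=\int f(x)e^{-i\xi x}dx$). Classical Hurwitz zeta: $\zeta(s,a)=\sum_{k\ge0}(a+k)^{-s}$. Standing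 assumption: $R\subset\{w\in\mathbb{C}:\mathrm{Re}\,w>1\}$ with $\overline R=R$ and $\zeta(w,\alpha)+e^{-i\pi w}\zeta(w,1-\alpha)\ne0$ for all $w\in R$, $\alpha\in(0,1)$; $Q_R:=\{q=a+v\in\mathbb{H}_\mathbb{R}: v\ne0,\ a+i|v|\in R\}$. For $q\in Q_R$, $\sum_k\widehat{B_q}(\xi+2\pi k)$ is invertible for every $\xi$, and the fundamental cardinal spline is $L_q(x):=\frac1{2\pi}\int_\mathbb{R}\widehat{B_q}(\xi)\big(\sum_k\widehat{B_q}(\xi+2\pi k)\big)^{-1}e^{i\xi x}d\xi$, which satisfies $L_q(m)=\delta_{m,0}$, $m\in\mathbb{Z}$. *)

theory Defs
  imports "HOL-Analysis.Analysis"
begin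

text \<open>Real quaternions a + v1 e1 + v2 e2 + v3 e3 are represented as real^4 (component 0 is
the scalar part, components 1,2,3 the vector part); complex quaternions as complex^4.
The norm on complex^4 is the Euclidean one, (sum |q_j|^2)^(1/2).\<close>

type_synonym hqr = "real^4"
type_synonym hqc = "complex^4"

definition hq :: "complex \<Rightarrow> complex \<Rightarrow> complex \<Rightarrow> complex \<Rightarrow> hqc" where
  "hq a b c d = (\<chi> j. if j = 0 then a else if j = 1 then b else if j = 2 then c else d)"

text \<open>Hamilton product: e1 e2 = e3, e2 e3 = e1, e3 e1 = e2, ej^2 = -1; i commutes with all ej.\<close>
definition qmult :: "hqc \<Rightarrow> hqc \<Rightarrow> hqc" where
  "qmult p q = hq
     (p$0*q$0 - p$1*q$1 - p$2*q$2 - p$3*q$3)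
     (p$0*q$1 + p$1*q$0 + p$2*q$3 - p$3*q$2)
     (p$0*q$2 - p$1*q$3 + p$2*q$0 + p$3*q$1)
     (p$0*q$3 + p$1*q$2 - p$2*q$1 + p$3*q$0)"

text \<open>Inverse of a complex quaternion (valid when q0^2+q1^2+q2^2+q3^2 is nonzero).\<close>
definition qinv :: "hqc \<Rightarrow> hqc" where
  "qinv q = (let n = q$0^2 + q$1^2 + q$2^2 + q$3^2 in
             hq (q$0 / n) (- q$1 / n) (- q$2 / n) (- q$3 / n))"

definition cscale :: "complex \<Rightarrow> hqc \<Rightarrow> hqc" where
  "cscale c q = (\<chi> j. c * q$j)"

definition hqr_to_hqc :: "hqr \<Rightarrow> hqc" where
  "hqr_to_hqc q = (\<chi> j. complex_of_real (q$j))"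

definition Sc :: "hqr \<Rightarrow> real" where "Sc q = q$0"
definition vnorm :: "hqr \<Rightarrow> real" where "vnorm q = sqrt ((q$1)^2 + (q$2)^2 + (q$3)^2)"

definition qpow :: "complex \<Rightarrow> hqr \<Rightarrow> hqc" where
  "qpow z q = (if z = 0 then 0 else
     (let n = vnorm q; L = Ln z; s = sin (complex_of_real n * L) in
       cscale (z powr complex_of_real (Sc q))
         (hq (cos (complex_of_real n * L))
             (s * complex_of_real (q$1 / n))
             (s * complex_of_real (q$2 / n))
             (s * complex_of_real (q$3 / n)))))"

definition Xi :: "real \<Rightarrow> complex" where
  "Xi \<xi> = (if \<xi> = 0 then 1 else (1 - exp (- \<i> * complex_of_real \<xi>)) / (\<i> * complex_of_real \<xi>))"

definition BqHat :: "hqr \<Rightarrow> real \<Rightarrow> hqc" where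
  "BqHat q \<xi> = qpow (Xi \<xi>) q"

text \<open>Inverse Fourier transform (convention hat f(xi) = int f(x) e^{-i xi x} dx).\<close>
definition Bspl :: "hqr \<Rightarrow> real \<Rightarrow> hqc" where
  "Bspl q x = cscale (complex_of_real (1 / (2 * pi)))
     (integral UNIV (\<lambda>\<xi>. cscale (exp (\<i> * complex_of_real (\<xi> * x))) (BqHat q \<xi>)))"

definition Per :: "hqr \<Rightarrow> real \<Rightarrow> hqc" where
  "Per q \<xi> = (\<Sum>\<^sub>\<infinity>k::int. BqHat q (\<xi> + 2 * pi * of_int k))"

definition Lq :: "hqr \<Rightarrow> real \<Rightarrow> hqc" where
  "Lq q x = cscale (complex_of_real (1 / (2 * pi)))
     (integral UNIV (\<lambda>\<xi>. cscale (exp (\<i> * complex_of_real (\<xi> * x)))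
                            (qmult (BqHat q \<xi>) (qinv (Per q \<xi>)))))"

text \<open>Classical Hurwitz zeta function (for Re s > 1, a > 0).\<close>
definition hurwitz_zeta :: "complex \<Rightarrow> real \<Rightarrow> complex" where
  "hurwitz_zeta s a = (\<Sum>k. complex_of_real (a + real k) powr (- s))"

definition QR :: "complex set \<Rightarrow> hqr set" where
  "QR R = {q. vnorm q \<noteq> 0 \<and> Complex (Sc q) (vnorm q) \<in> R}"

definition in_Hq :: "hqr \<Rightarrow> (real \<Rightarrow> hqc) \<Rightarrow> bool" where
  "in_Hq q f \<longleftrightarrow> (\<exists>a :: int \<Rightarrow> hqc. (\<lambda>k. (norm (a k))^2) summable_on UNIV \<and>
     (\<forall>x. (\<lambda>N::nat. \<Sum>k\<in>{- int N..int N}. qmult (a k) (Bspl q (x - of_int k))) \<longlonglongrightarrow> f x))"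

definition cardinal_partial :: "hqr \<Rightarrow> (real \<Rightarrow> hqc) \<Rightarrow> nat \<Rightarrow> real \<Rightarrow> hqc" where
  "cardinal_partial q f N t = (\<Sum>k\<in>{- int N..int N}. qmult (f (of_int k)) (Lq q (t - of_int k)))"

end

theory Submission
  imports Defs
begin

text \<open>
  With \<open>u = v / |v|\<close>, the elements \<open>(1 \<mp> \<i> u) / 2\<close> are orthogonal idempotents on which
  \<open>z\<^sup>q\<close> acts as \<open>z\<^sup>w\<close> with \<open>w = a \<plusminus> \<i> |v|\<close>, so \<open>B\<^sub>q\<close> and \<open>L\<^sub>q\<close> split into two complex
  splines and it suffices to treat \<open>g = \<Xi>\<^sup>w\<close>, with spline \<open>B\<close>, and \<open>l = g / \<Sum>\<^sub>k g(\<cdot> + 2\<pi>k)\<close>, with \<open>L\<close>.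
  For each \<open>t\<close> the numbers \<open>L(t + m)\<close> are the Fourier coefficients of the Zak transform
  \<open>\<Sum>\<^sub>k l(\<xi> + 2\<pi>k) exp(\<i> (\<xi> + 2\<pi>k) t)\<close>, which is bounded uniformly in \<open>t\<close>. Bessel's inequality
  therefore gives \<open>\<Sum>\<^sub>m |\<Sum>\<^sub>k c\<^sub>k L(t + m - k)|\<^sup>2 \<le> M\<^sup>2 \<Sum>\<^sub>k |c\<^sub>k|\<^sup>2\<close> with \<open>M\<close> independent of \<open>t\<close>, and
  likewise for \<open>B\<close>. Reading off one \<open>m\<close> yields uniform convergence, and integrating over a unit interval
  yields convergence in \<open>L\<^sup>2\<close>, without Plancherel on the line. The limit is identified
  on the generators: Parseval on the circle gives \<open>B(t - j) = \<Sum>\<^sub>k B(k - j) L(t - k)\<close>.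
\<close>

section \<open>Trigonometric coefficients and Parseval on the circle\<close>

text \<open>The exponent carries the sign of the inverse Fourier transform, so this is the usual
  Fourier coefficient of index \<open>- m\<close>. With this choice the value of a spline at
  \<open>t + m\<close> gets index \<open>m\<close>, see
  \<open>inv_fourier_eq_trig_coeff\<close>.\<close>

definition trig_coeff :: "(real \<Rightarrow> complex) \<Rightarrow> int \<Rightarrow> complex" where
  "trig_coeff Z m = integral {-pi..pi} (\<lambda>\<xi>. Z \<xi> * cis (of_int m * \<xi>)) / (2 * pi)"

lemma cis_of_int_2pi [simp]: "cis (2 * pi * of_int k) = 1"
  using cis_multiple_2pi[of "of_int k"] by simp

lemma integral_cis_int:
  "integral {-pi..pi} (\<lambda>\<xi>. cis (of_int m * \<xi>)) = (if m = 0 then 2 * pi else 0)"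
proof (cases "m = 0")
  case True then show ?thesis by (simp add: scaleR_conv_of_real)
next
  case False
  have "((\<lambda>\<xi>. cis (of_int m * \<xi>)) has_integral
     cis (of_int m * pi) / (\<i> * of_int m) - cis (of_int m * (- pi)) / (\<i> * of_int m)) {-pi..pi}"
  proof (rule fundamental_theorem_of_calculus)
    fix x
    have "((\<lambda>z. exp (\<i> * of_int m * z) / (\<i> * of_int m)) has_field_derivative exp (\<i> * of_int m * z)) (at z)"
      for z :: complex
      by (rule derivative_eq_intros refl | use False in force)+
    from has_vector_derivative_real_field[OF this[of "of_real x"], of "{-pi..pi}"]
    show "((\<lambda>\<xi>. cis (of_int m * \<xi>) / (\<i> * of_int m)) has_vector_derivative cis (of_int m * x))
        (at x within {- pi..pi})"
      by (simp add: cis_conv_exp mult.assoc)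
  qed auto
  moreover have "cis (of_int m * pi) = cis (of_int m * (- pi)) * cis (2 * pi * of_int m)"
    unfolding cis_mult by (rule arg_cong[of _ _ cis]) (simp add: algebra_simps)
  ultimately show ?thesis using False by (simp add: integral_unique)
qed

lemma trig_coeff_cis: "trig_coeff (\<lambda>\<xi>. cis (of_int j * \<xi>)) k = (if j + k = 0 then 1 else 0)"
  using integral_cis_int[of "j + k"]
  by (simp add: trig_coeff_def cis_mult ring_distribs flip: of_int_add distrib_right)

lemma trig_integrable:
  "continuous_on {-pi..pi} Z \<Longrightarrow> (\<lambda>\<xi>. Z \<xi> * cis (of_int m * \<xi>)) integrable_on {-pi..pi}"
  by (intro integrable_continuous_real continuous_intros)

lemma trig_coeff_add:
  assumes "continuous_on {-pi..pi} Z" "continuous_on {-pi..pi} W"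
  shows "trig_coeff (\<lambda>\<xi>. Z \<xi> + W \<xi>) m = trig_coeff Z m + trig_coeff W m"
  using integral_add[OF trig_integrable[OF assms(1)] trig_integrable[OF assms(2)], of m m]
  by (simp add: trig_coeff_def ring_distribs add_divide_distrib)

lemma trig_coeff_mult_left: "trig_coeff (\<lambda>\<xi>. c * Z \<xi>) m = c * trig_coeff Z m"
  by (simp add: trig_coeff_def mult.assoc)

lemma trig_coeff_diff:
  assumes "continuous_on {-pi..pi} Z" "continuous_on {-pi..pi} W"
  shows "trig_coeff (\<lambda>\<xi>. Z \<xi> - W \<xi>) m = trig_coeff Z m - trig_coeff W m"
  using integral_diff[OF trig_integrable[OF assms(1)] trig_integrable[OF assms(2)], of m m]
  by (simp add: trig_coeff_def ring_distribs diff_divide_distrib)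

lemma trig_coeff_sum:
  assumes "finite I" "\<And>i. i \<in> I \<Longrightarrow> continuous_on {-pi..pi} (Z i)"
  shows "trig_coeff (\<lambda>\<xi>. \<Sum>i\<in>I. Z i \<xi>) m = (\<Sum>i\<in>I. trig_coeff (Z i) m)"
  using assms
  by (simp add: trig_coeff_def sum_distrib_right trig_integrable integral_sum sum_divide_distrib)

lemma trig_coeff_shift:
  "trig_coeff (\<lambda>\<xi>. cis (of_int j * \<xi>) * Z \<xi>) m = trig_coeff Z (m + j)"
  by (simp add: trig_coeff_def mult.assoc mult.left_commute cis_mult ring_distribs add.commute)

lemma trig_coeff_le:
  assumes "continuous_on {-pi..pi} Z" "\<And>\<xi>. \<xi> \<in> {-pi..pi} \<Longrightarrow> cmod (Z \<xi>) \<le> M"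
  shows "cmod (trig_coeff Z m) \<le> M"
proof -
  have "cmod (integral {-pi..pi} (\<lambda>\<xi>. Z \<xi> * cis (of_int m * \<xi>))) \<le> integral {-pi..pi} (\<lambda>\<xi>. M)"
    using assms by (intro integral_norm_bound_integral trig_integrable) (auto simp: norm_mult)
  then show ?thesis
    by (simp add: trig_coeff_def norm_divide divide_le_eq mult.commute)
qed

text \<open>The squared distance in L2 from \<open>Z\<close> to its own partial sum over
  \<open>K\<close> is nonnegative; expanding it gives the first claim. The expansion needs the norm
  of a trigonometric polynomial, which is the second claim. The exponents \<open>- k\<close> match
  the sign in \<open>trig_coeff\<close>.\<close>

lemma Bessel_inequality:
  assumes Z: "continuous_on {-pi..pi} Z" and "finite K"
  shows "(\<Sum>m\<in>K. (cmod (trig_coeff Z m))\<^sup>2) \<le> integral {-pi..pi} (\<lambda>\<xi>. (cmod (Z \<xi>))\<^sup>2) / (2 * pi)"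
    and Bessel_trig_polynomial: "Z = (\<lambda>\<xi>. \<Sum>k\<in>K. c k * cis (- of_int k * \<xi>)) \<Longrightarrow>
      integral {-pi..pi} (\<lambda>\<xi>. (cmod (Z \<xi>))\<^sup>2) = 2 * pi * (\<Sum>k\<in>K. (cmod (c k))\<^sup>2)"
proof -
  define z where "z = trig_coeff Z"
  define P :: "(int \<Rightarrow> complex) \<Rightarrow> real \<Rightarrow> complex"
    where "P = (\<lambda>c \<xi>. \<Sum>k\<in>K. c k * cis (- of_int k * \<xi>))"
  have P: "continuous_on {-pi..pi} (P c)" for c unfolding P_def by (intro continuous_intros)
  \<comment> \<open>Pairing with a polynomial only sees the coefficients on \<open>K\<close>. This
    is applied twice: to \<open>W = P c\<close> for orthogonality and to \<open>W = Z\<close> for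
    the mixed term.\<close>
  have cP: "integral {-pi..pi} (\<lambda>\<xi>. W \<xi> * cnj (P c \<xi>)) = 2 * pi * (\<Sum>k\<in>K. cnj (c k) * trig_coeff W k)"
    if W: "continuous_on {-pi..pi} W" for W c
  proof -
    have "W \<xi> * cnj (P c \<xi>) = (\<Sum>k\<in>K. cnj (c k) * (W \<xi> * cis (of_int k * \<xi>)))" for \<xi>
      by (simp add: P_def sum_distrib_left cis_cnj algebra_simps)
    then have "integral {-pi..pi} (\<lambda>\<xi>. W \<xi> * cnj (P c \<xi>)) =
       (\<Sum>k\<in>K. integral {-pi..pi} (\<lambda>\<xi>. cnj (c k) * (W \<xi> * cis (of_int k * \<xi>))))"
      by (simp only:) (intro integral_sum \<open>finite K\<close> integrable_continuous_real continuous_intros W)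
    then show ?thesis by (simp add: trig_coeff_def sum_distrib_left)
  qed
  have tP: "trig_coeff (P c) k = c k" if "k \<in> K" for c k
  proof -
    have "trig_coeff (P c) k = (\<Sum>j\<in>K. c j * trig_coeff (\<lambda>\<xi>. cis (of_int (-j) * \<xi>)) k)"
      unfolding P_def using \<open>finite K\<close>
      by (subst trig_coeff_sum) (auto intro!: continuous_intros simp: trig_coeff_mult_left)
    also have "\<dots> = (\<Sum>j\<in>K. if j = k then c k else 0)"
      unfolding trig_coeff_cis by (intro sum.cong) auto
    finally show ?thesis using that \<open>finite K\<close> by simp
  qed
  have nsq: "of_real (integral {-pi..pi} (\<lambda>\<xi>. (cmod (W \<xi>))\<^sup>2)) = integral {-pi..pi} (\<lambda>\<xi>. W \<xi> * cnj (W \<xi>))"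
    if W: "continuous_on {-pi..pi} W" for W
  proof -
    have "(\<lambda>\<xi>. (cmod (W \<xi>))\<^sup>2) integrable_on {-pi..pi}"
      by (intro integrable_continuous_real continuous_intros W)
    then show ?thesis
      using integral_linear[of "\<lambda>\<xi>. (cmod (W \<xi>))\<^sup>2" "{-pi..pi}" complex_of_real]
      by (simp add: bounded_linear_of_real o_def complex_norm_square flip: of_real_power)
  qed
  have PP: "integral {-pi..pi} (\<lambda>\<xi>. (cmod (P c \<xi>))\<^sup>2) = 2 * pi * (\<Sum>k\<in>K. (cmod (c k))\<^sup>2)" for c
  proof -
    have "complex_of_real (integral {-pi..pi} (\<lambda>\<xi>. (cmod (P c \<xi>))\<^sup>2)) = 2 * pi * (\<Sum>k\<in>K. cnj (c k) * c k)"
      using P by (simp add: nsq cP tP)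
    also have "\<dots> = of_real (2 * pi * (\<Sum>k\<in>K. (cmod (c k))\<^sup>2))"
      by (simp add: complex_norm_square mult.commute flip: of_real_power)
    finally show ?thesis by (simp only: of_real_eq_iff)
  qed
  show "integral {-pi..pi} (\<lambda>\<xi>. (cmod (Z \<xi>))\<^sup>2) = 2 * pi * (\<Sum>k\<in>K. (cmod (c k))\<^sup>2)"
    if "Z = (\<lambda>\<xi>. \<Sum>k\<in>K. c k * cis (- of_int k * \<xi>))"
    using PP[of c] that by (simp add: P_def)
  have i1: "(\<lambda>\<xi>. (cmod (Z \<xi>))\<^sup>2) integrable_on {-pi..pi}"
    and i2: "(\<lambda>\<xi>. (cmod (P z \<xi>))\<^sup>2) integrable_on {-pi..pi}"
    and i3: "(\<lambda>\<xi>. 2 * Re (Z \<xi> * cnj (P z \<xi>))) integrable_on {-pi..pi}"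
    and i4: "(\<lambda>\<xi>. Z \<xi> * cnj (P z \<xi>)) integrable_on {-pi..pi}"
    by (intro integrable_continuous_real continuous_intros Z P)+
  have "0 \<le> integral {-pi..pi} (\<lambda>\<xi>. (cmod (Z \<xi> - P z \<xi>))\<^sup>2)"
    by (intro integral_nonneg integrable_continuous_real continuous_intros Z P) auto
  also have "(\<lambda>\<xi>. (cmod (Z \<xi> - P z \<xi>))\<^sup>2) =
     (\<lambda>\<xi>. (cmod (Z \<xi>))\<^sup>2 + (cmod (P z \<xi>))\<^sup>2 - 2 * Re (Z \<xi> * cnj (P z \<xi>)))"
    by (simp add: fun_eq_iff cmod_power2) (simp add: power2_eq_square algebra_simps)
  also have "integral {-pi..pi} \<dots> = integral {-pi..pi} (\<lambda>\<xi>. (cmod (Z \<xi>))\<^sup>2)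
     + integral {-pi..pi} (\<lambda>\<xi>. (cmod (P z \<xi>))\<^sup>2) - integral {-pi..pi} (\<lambda>\<xi>. 2 * Re (Z \<xi> * cnj (P z \<xi>)))"
    by (subst integral_diff[OF integrable_add[OF i1 i2] i3]) (simp add: integral_add i1 i2)
  also have "integral {-pi..pi} (\<lambda>\<xi>. 2 * Re (Z \<xi> * cnj (P z \<xi>))) = 
     2 * Re (integral {-pi..pi} (\<lambda>\<xi>. Z \<xi> * cnj (P z \<xi>)))"
    unfolding integral_mult_right using integral_linear[OF i4 bounded_linear_Re] by (simp only: o_def)
  also have "\<dots> = 4 * pi * (\<Sum>k\<in>K. (cmod (z k))\<^sup>2)"
    by (simp add: cP Z flip: z_def)
       (simp add: Re_sum cmod_power2 flip: power2_eq_square)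
  finally show "(\<Sum>m\<in>K. (cmod (trig_coeff Z m))\<^sup>2) \<le> integral {-pi..pi} (\<lambda>\<xi>. (cmod (Z \<xi>))\<^sup>2) / (2 * pi)"
    by (simp add: PP z_def field_simps)
qed

text \<open>Convolution with the coefficients of \<open>Z\<close> is multiplication by
  \<open>Z\<close> on the circle, so its operator norm on square-summable sequences is at most the
  supremum \<open>M\<close>. Neither \<open>K\<close> nor \<open>I\<close> enters the constant,
  which later permits passing to infinite sums.\<close>

lemma trig_coeff_convolution_le:
  assumes Z: "continuous_on {-pi..pi} Z" and M: "\<And>\<xi>. \<xi> \<in> {-pi..pi} \<Longrightarrow> cmod (Z \<xi>) \<le> M"
    and fin: "finite K" "finite I"
  shows "(\<Sum>m\<in>K. (cmod (\<Sum>k\<in>I. c k * trig_coeff Z (m - k)))\<^sup>2) \<le> M\<^sup>2 * (\<Sum>k\<in>I. (cmod (c k))\<^sup>2)"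
proof -
  define C where "C = (\<lambda>\<xi>. \<Sum>k\<in>I. c k * cis (- of_int k * \<xi>))"
  have C: "continuous_on {-pi..pi} C" unfolding C_def by (intro continuous_intros)
  have eq: "(\<Sum>k\<in>I. c k * trig_coeff Z (m - k)) = trig_coeff (\<lambda>\<xi>. C \<xi> * Z \<xi>) m" for m
  proof -
    have "trig_coeff (\<lambda>\<xi>. C \<xi> * Z \<xi>) m =
        trig_coeff (\<lambda>\<xi>. \<Sum>k\<in>I. c k * (cis (of_int (-k) * \<xi>) * Z \<xi>)) m"
      by (simp add: C_def sum_distrib_right mult.assoc)
    also have "\<dots> = (\<Sum>k\<in>I. c k * trig_coeff Z (m - k))"
      using fin Z trig_coeff_shift[of "-k" Z m for k]
      by (subst trig_coeff_sum) (auto intro!: continuous_intros sum.cong simp: trig_coeff_mult_left)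
    finally show ?thesis by simp
  qed
  have "(\<Sum>m\<in>K. (cmod (\<Sum>k\<in>I. c k * trig_coeff Z (m - k)))\<^sup>2)
     \<le> integral {-pi..pi} (\<lambda>\<xi>. (cmod (C \<xi> * Z \<xi>))\<^sup>2) / (2 * pi)"
    unfolding eq by (intro Bessel_inequality continuous_intros Z C fin)
  also have "\<dots> \<le> integral {-pi..pi} (\<lambda>\<xi>. M\<^sup>2 * (cmod (C \<xi>))\<^sup>2) / (2 * pi)"
    using Z C M
    by (intro divide_right_mono integral_le integrable_continuous_real continuous_intros)
       (auto simp: norm_mult power_mult_distrib mult.commute[of "M\<^sup>2"] intro!: mult_left_mono power_mono)
  also have "\<dots> = M\<^sup>2 * (\<Sum>k\<in>I. (cmod (c k))\<^sup>2)"
    by (simp add: Bessel_trig_polynomial[OF C fin(2) C_def])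
  finally show ?thesis .
qed

section \<open>Density of trigonometric polynomials and Parseval's identity\<close>

inductive trig_poly :: "(real \<Rightarrow> complex) \<Rightarrow> bool" where
  monom: "trig_poly (\<lambda>\<xi>. c * cis (of_int j * \<xi>))"
| add: "trig_poly T \<Longrightarrow> trig_poly U \<Longrightarrow> trig_poly (\<lambda>\<xi>. T \<xi> + U \<xi>)"

lemma trig_poly_const: "trig_poly (\<lambda>\<xi>. c)"
  using trig_poly.monom[of c 0] by simp

lemma trig_poly_mult:
  assumes "trig_poly T" "trig_poly U"
  shows "trig_poly (\<lambda>\<xi>. T \<xi> * U \<xi>)"
  using assms
proof (induction T)
  case (monom c j)
  from monom show ?case
  proof (induction U)
    case (monom d k)
    show ?case using trig_poly.monom[of "c * d" "j + k"]
      by (simp add: mult.assoc mult.left_commute cis_mult ring_distribs)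
  qed (simp add: ring_distribs trig_poly.add)
qed (simp add: ring_distribs trig_poly.add)

lemma trig_poly_continuous: "trig_poly T \<Longrightarrow> continuous_on S T"
  by (induction rule: trig_poly.induct) (auto intro!: continuous_intros)

text \<open>Induction over polynomial functions: constants, sums and products stay trigonometric
  polynomials, and a real-linear function of a point of the circle is a combination of the
  exponentials of frequency 1 and -1.\<close>

lemma trig_poly_real_polynomial:
  assumes "real_polynomial_function (g :: complex \<Rightarrow> real)"
  shows "trig_poly (\<lambda>\<xi>. of_real (g (cis \<xi>)))"
  using assms
proof induction
  case (linear f)
  have fz: "f z = Re z * f 1 + Im z * f \<i>" for z
  proof -
    interpret bounded_linear f by fact
    have "f (Re z *\<^sub>R 1 + Im z *\<^sub>R \<i>) = Re z * f 1 + Im z * f \<i>"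
      by (simp only: add scaleR real_scaleR_def)
    moreover have "Re z *\<^sub>R 1 + Im z *\<^sub>R \<i> = z" by (simp add: complex_eq_iff)
    ultimately show ?thesis by simp
  qed
  \<comment> \<open>Euler's formulas inserted into
    \<open>f 1 * cos \<xi> + f \<i> * sin \<xi>\<close>.\<close>
  have "complex_of_real (f (cis \<xi>)) = (f 1 + f \<i> / \<i>) / 2 * cis (of_int 1 * \<xi>) + (f 1 - f \<i> / \<i>) / 2 * cis (of_int (-1) * \<xi>)" for \<xi>
    unfolding fz[of "cis \<xi>"] by (simp add: complex_eq_iff field_simps)
  then show ?case by (simp only: trig_poly.intros)
qed (auto simp: trig_poly_const trig_poly_mult trig_poly.add)

text \<open>\<open>Arg\<close> jumps at -1, so continuity of \<open>P\<close> composed with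
  \<open>Arg\<close> cannot be read off from \<open>Arg\<close>. Instead \<open>cis\<close> maps the
  compact interval onto the circle as a quotient map, and continuity of \<open>P\<close> descends
  along it.\<close>

lemma continuous_factor_circle:
  fixes P :: "real \<Rightarrow> 'a::topological_space"
  assumes P: "continuous_on {-pi..pi} P" and per: "P (-pi) = P pi"
  obtains g where "continuous_on (sphere 0 1) g" "\<And>\<xi>. \<xi> \<in> {-pi..pi} \<Longrightarrow> g (cis \<xi>) = P \<xi>"
proof -
  define g where "g = (\<lambda>z. P (Arg z))"
  have g: "g (cis \<xi>) = P \<xi>" if "\<xi> \<in> {-pi..pi}" for \<xi>
  proof (cases "\<xi> = -pi")
    case True
    \<comment> \<open>\<open>Arg\<close> takes the value \<open>pi\<close> at -1, never
      \<open>- pi\<close>; the equality of the two end values of \<open>P\<close> bridges the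
      gap.\<close>
    have "cis (-pi) = cis pi" by (simp add: complex_eq_iff)
    with True show ?thesis using per Arg_cis[of pi] by (simp add: g_def del: cis_pi)
  next
    case False
    then have "Arg (cis \<xi>) = \<xi>" using that by (intro Arg_cis) auto
    then show ?thesis by (simp add: g_def)
  qed
  have im: "cis ` {-pi..pi} = sphere 0 1"
  proof -
    have "z \<in> cis ` {-pi..pi}" if "cmod z = 1" for z
    proof
      show "z = cis (Arg z)" using that by (metis cis_Arg norm_eq_zero sgn_div_norm scaleR_one inverse_1 zero_neq_one)
      show "Arg z \<in> {-pi..pi}" using Arg_bounded[of z] by auto
    qed
    then show ?thesis by auto
  qed
  have "openin (top_of_set (sphere 0 1)) (sphere 0 1 \<inter> g -` V)" if "open V" for V
  proof -
    have "{-pi..pi} \<inter> cis -` (sphere 0 1 \<inter> g -` V) = {-pi..pi} \<inter> P -` V"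
      using g by auto
    moreover have "openin (top_of_set {-pi..pi}) ({-pi..pi} \<inter> P -` V)"
      using P \<open>open V\<close> by (simp add: continuous_openin_preimage_gen)
    moreover have "continuous_on {-pi..pi} cis" by (intro continuous_intros)
    ultimately show ?thesis
      using Abstract_Topology_2.continuous_imp_quotient_map[OF _ im, of "sphere 0 1 \<inter> g -` V"] by simp
  qed
  then have "continuous_on (sphere 0 1) g"
    by (simp add: continuous_on_open_gen[of _ _ UNIV])
  then show ?thesis by (rule that) (rule g)
qed

text \<open>Stone-Weierstrass on the circle, applied separately to the real and the imaginary part,
  each with error \<open>\<epsilon> / 2\<close>.\<close>

lemma trig_poly_dense:
  assumes P: "continuous_on {-pi..pi} P" and per: "P (-pi) = P pi" and "\<epsilon> > 0"
  obtains T where "trig_poly T" "\<And>\<xi>. \<xi> \<in> {-pi..pi} \<Longrightarrow> cmod (P \<xi> - T \<xi>) < \<epsilon>"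
proof -
  obtain g where g: "continuous_on (sphere 0 1) g" "\<And>\<xi>. \<xi> \<in> {-pi..pi} \<Longrightarrow> g (cis \<xi>) = P \<xi>"
    using continuous_factor_circle[OF P per] by blast
  have c: "compact (sphere 0 1 :: complex set)" by simp
  obtain h1 where h1: "real_polynomial_function h1" "\<And>z. z \<in> sphere 0 1 \<Longrightarrow> \<bar>Re (g z) - h1 z\<bar> < \<epsilon> / 2"
    using Stone_Weierstrass_real_polynomial_function[OF c continuous_on_Re[OF g(1)]] \<open>\<epsilon> > 0\<close>
    by (metis half_gt_zero)
  obtain h2 where h2: "real_polynomial_function h2" "\<And>z. z \<in> sphere 0 1 \<Longrightarrow> \<bar>Im (g z) - h2 z\<bar> < \<epsilon> / 2"
    using Stone_Weierstrass_real_polynomial_function[OF c continuous_on_Im[OF g(1)]] \<open>\<epsilon> > 0\<close>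
    by (metis half_gt_zero)
  let ?T = "\<lambda>\<xi>. of_real (h1 (cis \<xi>)) + \<i> * of_real (h2 (cis \<xi>))"
  show ?thesis
  proof (rule that[of ?T])
    show "trig_poly ?T"
      by (intro trig_poly.add trig_poly_mult trig_poly_const trig_poly_real_polynomial h1 h2)
    fix \<xi> assume "\<xi> \<in> {-pi..pi}"
    then have "P \<xi> = g (cis \<xi>)" by (simp add: g)
    then show "cmod (P \<xi> - ?T \<xi>) < \<epsilon>"
      using h1(2)[of "cis \<xi>"] h2(2)[of "cis \<xi>"] cmod_le[of "P \<xi> - ?T \<xi>"] by simp
  qed
qed

text \<open>An exponential has a single nonzero coefficient, so its symmetric sums become constant
  as soon as they contain that index. Equality, not just convergence, holds from some
  \<open>N\<close> on, and this property is stable under addition.\<close>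

lemma Parseval_trig_poly:
  assumes "trig_poly T" and Z: "continuous_on {-pi..pi} Z"
  shows "\<forall>\<^sub>F N in sequentially. (\<Sum>k\<in>{- int N..int N}. trig_coeff T k * trig_coeff Z (- k))
      = trig_coeff (\<lambda>\<xi>. T \<xi> * Z \<xi>) 0"
  using assms(1)
proof induction
  case (monom c j)
  have "(\<Sum>k\<in>{- int N..int N}. trig_coeff (\<lambda>\<xi>. c * cis (of_int j * \<xi>)) k * trig_coeff Z (- k))
      = trig_coeff (\<lambda>\<xi>. c * cis (of_int j * \<xi>) * Z \<xi>) 0" if "N \<ge> nat \<bar>j\<bar>" for N
  proof -
    have "(\<Sum>k\<in>{- int N..int N}. trig_coeff (\<lambda>\<xi>. c * cis (of_int j * \<xi>)) k * trig_coeff Z (- k))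
      = (\<Sum>k\<in>{- int N..int N}. if k = -j then c * trig_coeff Z j else 0)"
      by (intro sum.cong) (auto simp: trig_coeff_mult_left trig_coeff_cis)
    also have "\<dots> = c * trig_coeff Z j" using that by auto
    also have "\<dots> = trig_coeff (\<lambda>\<xi>. c * cis (of_int j * \<xi>) * Z \<xi>) 0"
      by (simp add: mult.assoc trig_coeff_mult_left trig_coeff_shift)
    finally show ?thesis .
  qed
  then show ?case using eventually_sequentially by blast
next
  case (add T U)
  from add.IH show ?case
  proof eventually_elim
    case (elim N)
    then show ?case
      using trig_poly_continuous[OF add.hyps(1)] trig_poly_continuous[OF add.hyps(2)] Z
      by (simp add: trig_coeff_add ring_distribs sum.distrib continuous_on_mult)
  qed
qed

text \<open>\<open>P\<close> is replaced by a uniformly close trigonometric polynomial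
  \<open>T\<close>. The difference \<open>E\<close> costs at most \<open>\<delta> * M\<close> in
  every partial sum, by Cauchy-Schwarz and Bessel, and at most \<open>\<delta> * M\<close> in the
  limit, both independently of \<open>N\<close>.\<close>

lemma Parseval_continuous:
  assumes P: "continuous_on {-pi..pi} P" and per: "P (-pi) = P pi" and Z: "continuous_on {-pi..pi} Z"
  shows "(\<lambda>N. \<Sum>k\<in>{- int N..int N}. trig_coeff P k * trig_coeff Z (- k))
      \<longlonglongrightarrow> trig_coeff (\<lambda>\<xi>. P \<xi> * Z \<xi>) 0"
proof (rule metric_LIMSEQ_I)
  fix \<epsilon> :: real assume "\<epsilon> > 0"
  have "bounded (Z ` {-pi..pi})" using Z by (intro compact_imp_bounded compact_continuous_image) auto
  then obtain M where M: "M > 0" "\<And>\<xi>. \<xi> \<in> {-pi..pi} \<Longrightarrow> cmod (Z \<xi>) \<le> M"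
    unfolding bounded_pos by auto
  \<comment> \<open>The two errors of size \<open>\<delta> * M\<close> then add up to two thirds of
    \<open>\<epsilon>\<close>, which leaves the final inequality strict.\<close>
  define \<delta> where "\<delta> = \<epsilon> / (3 * M)"
  have \<delta>: "\<delta> > 0" using \<open>\<epsilon> > 0\<close> M by (simp add: \<delta>_def)
  obtain T where T: "trig_poly T" "\<And>\<xi>. \<xi> \<in> {-pi..pi} \<Longrightarrow> cmod (P \<xi> - T \<xi>) < \<delta>"
    using trig_poly_dense[OF P per \<delta>] by metis
  have cT: "continuous_on {-pi..pi} T" using T(1) by (rule trig_poly_continuous)
  define E where "E = (\<lambda>\<xi>. P \<xi> - T \<xi>)"
  have E: "continuous_on {-pi..pi} E" unfolding E_def by (intro continuous_intros P cT)
  have E\<delta>: "cmod (E \<xi>) \<le> \<delta>" if "\<xi> \<in> {-pi..pi}" for \<xi> using T(2)[OF that] by (simp add: E_def)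
  have b: "cmod (\<Sum>k\<in>{- int N..int N}. trig_coeff E k * trig_coeff Z (- k)) \<le> \<delta> * M" for N
  proof -
    \<comment> \<open>Bessel's inequality in supremum form: the convolution bound for the sequence
      that is 1 at index 0.\<close>
    have sq: "(\<Sum>m\<in>K. (cmod (trig_coeff W m))\<^sup>2) \<le> B\<^sup>2"
      if "continuous_on {-pi..pi} W" "\<And>\<xi>. \<xi> \<in> {-pi..pi} \<Longrightarrow> cmod (W \<xi>) \<le> B" "finite K" for W K B
      using trig_coeff_convolution_le[OF that, of "{0}" "\<lambda>_. 1"] by simp
    \<comment> \<open>The sign \<open>s\<close> serves the coefficients of \<open>Z\<close>, which
      occur at \<open>- k\<close>; the symmetric index range is invariant under negation.\<close>
    have l2: "L2_set (\<lambda>m. cmod (trig_coeff W (s * m))) {- int N..int N} \<le> B"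
      if "continuous_on {-pi..pi} W" "\<And>\<xi>. \<xi> \<in> {-pi..pi} \<Longrightarrow> cmod (W \<xi>) \<le> B" "B > 0" "s \<in> {1,-1}" for W B s
    proof -
      have "(\<Sum>m\<in>{- int N..int N}. (cmod (trig_coeff W (s * m)))\<^sup>2)
         = (\<Sum>m\<in>{- int N..int N}. (cmod (trig_coeff W m))\<^sup>2)"
        using that(4) by (intro sum.reindex_bij_witness[where i = "\<lambda>m. s * m" and j = "\<lambda>m. s * m"]) auto
      with sq[OF that(1,2), of "{- int N..int N}"] show ?thesis
        using that(3) unfolding L2_set_def by (intro real_le_lsqrt) auto
    qed
    have "cmod (\<Sum>k\<in>{- int N..int N}. trig_coeff E k * trig_coeff Z (- k))
       \<le> (\<Sum>k\<in>{- int N..int N}. \<bar>cmod (trig_coeff E k)\<bar> * \<bar>cmod (trig_coeff Z (- k))\<bar>)"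
      by (rule order_trans[OF norm_sum]) (simp add: norm_mult)
    also have "\<dots> \<le> L2_set (\<lambda>m. cmod (trig_coeff E m)) {- int N..int N} * L2_set (\<lambda>m. cmod (trig_coeff Z (- m))) {- int N..int N}"
      by (rule L2_set_mult_ineq)
    also have "\<dots> \<le> \<delta> * M"
      using l2[OF E E\<delta> \<delta>, of 1] l2[OF Z M(2,1), of "-1"] \<delta> by (intro mult_mono) (auto simp: L2_set_nonneg)
    finally show ?thesis .
  qed
  have c: "cmod (trig_coeff (\<lambda>\<xi>. E \<xi> * Z \<xi>) 0) \<le> \<delta> * M"
    using E\<delta> M \<delta> by (intro trig_coeff_le continuous_intros E Z) (auto simp: norm_mult intro!: mult_mono)
  obtain N0 where N0: "\<And>N. N \<ge> N0 \<Longrightarrow> (\<Sum>k\<in>{- int N..int N}. trig_coeff T k * trig_coeff Z (- k))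
      = trig_coeff (\<lambda>\<xi>. T \<xi> * Z \<xi>) 0"
    using Parseval_trig_poly[OF T(1) Z] unfolding eventually_sequentially by blast
  have "dist (\<Sum>k\<in>{- int N..int N}. trig_coeff P k * trig_coeff Z (- k)) (trig_coeff (\<lambda>\<xi>. P \<xi> * Z \<xi>) 0) < \<epsilon>"
    if "N \<ge> N0" for N
  proof -
    have 1: "trig_coeff E k = trig_coeff P k - trig_coeff T k" for k
      unfolding E_def by (rule trig_coeff_diff[OF P cT])
    have 2: "trig_coeff (\<lambda>\<xi>. E \<xi> * Z \<xi>) 0 = trig_coeff (\<lambda>\<xi>. P \<xi> * Z \<xi>) 0 - trig_coeff (\<lambda>\<xi>. T \<xi> * Z \<xi>) 0"
      unfolding E_def left_diff_distrib by (intro trig_coeff_diff continuous_intros P cT Z)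
    have 3: "(\<Sum>k\<in>{- int N..int N}. trig_coeff P k * trig_coeff Z (- k)) - trig_coeff (\<lambda>\<xi>. P \<xi> * Z \<xi>) 0
      = (\<Sum>k\<in>{- int N..int N}. trig_coeff E k * trig_coeff Z (- k)) - trig_coeff (\<lambda>\<xi>. E \<xi> * Z \<xi>) 0"
      using N0[OF that] by (simp add: 1 2 left_diff_distrib sum_subtractf)
    have "cmod \<dots> \<le> \<delta> * M + \<delta> * M" by (rule order_trans[OF norm_triangle_ineq4]) (use b[of N] c in linarith)
    also have "\<dots> < \<epsilon>" using M \<open>\<epsilon> > 0\<close> by (simp add: \<delta>_def)
    finally show ?thesis by (simp add: dist_norm 3)
  qed
  then show "\<exists>no. \<forall>N\<ge>no. dist (\<Sum>k\<in>{- int N..int N}. trig_coeff P k * trig_coeff Z (- k)) (trig_coeff (\<lambda>\<xi>. P \<xi> * Z \<xi>) 0) < \<epsilon>"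
    by blast
qed

section \<open>Periodization and the Zak transform\<close>

lemma summable_on_int_powr:
  assumes "\<sigma> > 1"
  shows "(\<lambda>k::int. (1 + \<bar>of_int k\<bar>) powr - \<sigma> :: real) summable_on UNIV"
proof -
  have "summable (\<lambda>n. real (Suc n) powr - \<sigma>)"
    using assms by (subst summable_Suc_iff) (simp add: summable_real_powr_iff)
  then have n: "(\<lambda>n. (1 + real n) powr - \<sigma>) summable_on UNIV"
    by (subst summable_on_UNIV_nonneg_real_iff) (simp_all add: add.commute)
  have "(\<lambda>k::int. (1 + \<bar>of_int k\<bar>) powr - \<sigma> :: real) summable_on range int"
    using n by (subst summable_on_reindex) (auto simp: o_def)
  moreover have "(\<lambda>k::int. (1 + \<bar>of_int k\<bar>) powr - \<sigma> :: real) summable_on range (\<lambda>n. - int n)"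
    using n by (subst summable_on_reindex) (auto simp: o_def inj_on_def)
  moreover have "range int \<union> range (\<lambda>n. - int n) = UNIV"
    by (auto simp: image_iff) (metis int_cases2)
  ultimately show ?thesis using summable_on_union by metis
qed

text \<open>Transfers unordered convergence over finite sets of integers to symmetric partial
  sums.\<close>

lemma filterlim_symmetric_int_intervals:
  "filterlim (\<lambda>N. {- int N..int N}) (finite_subsets_at_top UNIV) sequentially"
  unfolding filterlim_finite_subsets_at_top
proof (intro allI impI)
  fix X :: "int set" assume "finite X \<and> X \<subseteq> UNIV"
  then obtain B where B: "\<And>x. x \<in> X \<Longrightarrow> \<bar>x\<bar> \<le> B"
    by (metis abs_le_D1 finite_imageI finite_nat_iff_bounded_le Max_ge imageI)
  have "X \<subseteq> {- int N..int N}" if "N \<ge> nat B" for N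
    using B that by fastforce
  then show "\<forall>\<^sub>F N in sequentially. finite {- int N..int N} \<and> X \<subseteq> {- int N..int N} \<and> {- int N..int N} \<subseteq> UNIV"
    unfolding eventually_sequentially by auto
qed

text \<open>An inequality of Peetre type: \<open>1 + \<bar>k\<bar>\<close> is at most the product of
  \<open>1 + \<bar>\<xi>\<bar>\<close> and \<open>1 + \<bar>\<xi> + 2 * pi * k\<bar>\<close>. It
  separates a weight summable in \<open>k\<close> from a factor that is locally bounded in
  \<open>\<xi>\<close>.\<close>

lemma powr_periodic_shift_le:
  fixes \<xi> :: real and k :: int
  assumes "\<sigma> \<ge> 0"
  shows "(1 + \<bar>\<xi> + 2 * pi * of_int k\<bar>) powr - \<sigma> \<le> (1 + \<bar>\<xi>\<bar>) powr \<sigma> * (1 + \<bar>of_int k\<bar>) powr - \<sigma>"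
proof -
  have "\<bar>of_int k\<bar> \<le> 2 * pi * \<bar>of_int k :: real\<bar>"
    using pi_ge_two by (intro mult_le_cancel_right1[THEN iffD2]) auto
  also have "\<dots> \<le> \<bar>\<xi> + 2 * pi * of_int k\<bar> + \<bar>\<xi>\<bar>"
    using abs_triangle_ineq4[of "\<xi> + 2 * pi * of_int k" \<xi>] by (simp add: abs_mult)
  finally have "1 + \<bar>of_int k\<bar> \<le> 1 + \<bar>\<xi> + 2 * pi * of_int k\<bar> + \<bar>\<xi>\<bar>" by simp
  also have "\<dots> \<le> (1 + \<bar>\<xi>\<bar>) * (1 + \<bar>\<xi> + 2 * pi * of_int k\<bar>)"
    by (simp add: algebra_simps flip: abs_mult)
  finally have "(1 + \<bar>of_int k\<bar>) / (1 + \<bar>\<xi>\<bar>) \<le> 1 + \<bar>\<xi> + 2 * pi * of_int k\<bar>"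
    by (subst pos_divide_le_eq) (auto simp: mult.commute)
  then have "(1 + \<bar>\<xi> + 2 * pi * of_int k\<bar>) powr - \<sigma> \<le> ((1 + \<bar>of_int k\<bar>) / (1 + \<bar>\<xi>\<bar>)) powr - \<sigma>"
    using assms by (intro powr_mono2') (auto intro!: divide_pos_pos add_pos_nonneg)
  also have "\<dots> = (1 + \<bar>\<xi>\<bar>) powr \<sigma> * (1 + \<bar>of_int k\<bar>) powr - \<sigma>"
    by (simp add: powr_divide powr_minus field_simps)
  finally show ?thesis .
qed

text \<open>The interval consists of \<open>2 * N + 1\<close> translates of one period; the
  induction step adds one translate at each end.\<close>

lemma integral_symmetric_slices:
  fixes h :: "real \<Rightarrow> 'a::euclidean_space"
  assumes h: "continuous_on UNIV h"
  shows "integral {-((2 * real N + 1) * pi)..(2 * real N + 1) * pi} h =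
    integral {-pi..pi} (\<lambda>\<xi>. \<Sum>k\<in>{- int N..int N}. h (\<xi> + 2 * pi * of_int k))"
proof (induction N)
  case (Suc N)
  have ci: "h integrable_on {a..b}" for a b
    using h by (intro integrable_continuous_real) (auto intro: continuous_on_subset)
  have ci': "(\<lambda>\<xi>. h (\<xi> + c)) integrable_on {a..b}" for a b c
    by (intro integrable_continuous_real continuous_on_compose2[OF h] continuous_intros) auto
  let ?a = "(2 * real N + 1) * pi" and ?b = "(2 * real (Suc N) + 1) * pi"
  have set: "{- int (Suc N)..int (Suc N)} = insert (int (Suc N)) (insert (- int (Suc N)) {- int N..int N})"
    by auto
  have ab: "?a \<le> ?b" "- ?b \<le> - ?a" "- ?a \<le> ?a" by auto
  have "integral {-?b..?b} h = integral {-?b..-?a} h + integral {-?a..?a} h + integral {?a..?b} h"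
    using Henstock_Kurzweil_Integration.integral_combine[OF ab(2,3) ci]
      Henstock_Kurzweil_Integration.integral_combine[OF order_trans[OF ab(2,3)] ab(1) ci] by presburger
  also have "integral {-?b..-?a} h = integral {-pi..pi} (\<lambda>\<xi>. h (\<xi> + 2 * pi * of_int (- int (Suc N))))"
    using integral_shift_real_ivl[of "-?b" "2 * pi * of_int (- int (Suc N))" "-?a" h, symmetric]
    by (simp add: algebra_simps)
  also have "integral {?a..?b} h = integral {-pi..pi} (\<lambda>\<xi>. h (\<xi> + 2 * pi * of_int (int (Suc N))))"
    using integral_shift_real_ivl[of "?a" "2 * pi * of_int (int (Suc N))" "?b" h, symmetric]
    by (simp add: algebra_simps)
  also have "integral {-pi..pi} (\<lambda>\<xi>. h (\<xi> + 2 * pi * of_int (- int (Suc N)))) + integral {-?a..?a} h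
     + integral {-pi..pi} (\<lambda>\<xi>. h (\<xi> + 2 * pi * of_int (int (Suc N)))) =
     integral {-pi..pi} (\<lambda>\<xi>. \<Sum>k\<in>{- int (Suc N)..int (Suc N)}. h (\<xi> + 2 * pi * of_int k))"
  proof -
    have "(\<Sum>k\<in>{- int (Suc N)..int (Suc N)}. h (\<xi> + 2 * pi * of_int k)) =
      h (\<xi> + 2 * pi * of_int (- int (Suc N))) + (\<Sum>k\<in>{- int N..int N}. h (\<xi> + 2 * pi * of_int k))
       + h (\<xi> + 2 * pi * of_int (int (Suc N)))" for \<xi>
      unfolding set by (simp add: algebra_simps del: of_nat_Suc)
    moreover have "(\<lambda>\<xi>. \<Sum>k\<in>{- int N..int N}. h (\<xi> + 2 * pi * of_int k)) integrable_on {-pi..pi}"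
      by (intro integrable_sum ci') auto
    ultimately show ?thesis
      using Suc.IH by (simp only: integral_add integrable_add ci')
  qed
  finally show ?case by simp
qed simp

section \<open>Periodization of decaying functions\<close>

definition periodization :: "(real \<Rightarrow> 'a::{comm_monoid_add,t2_space}) \<Rightarrow> real \<Rightarrow> 'a" where
  "periodization g \<xi> = (\<Sum>\<^sub>\<infinity>k::int. g (\<xi> + 2 * pi * of_int k))"

lemma periodization_periodic: "periodization g (\<xi> + 2 * pi * of_int j) = periodization g \<xi>"
  unfolding periodization_def
  by (rule infsum_reindex_bij_witness[where i = "\<lambda>k. k - j" and j = "\<lambda>k. k + j"])
     (auto simp: algebra_simps)

lemma real_mod_2pi:
  fixes \<xi> :: real
  obtains k :: int where "\<xi> + 2 * pi * of_int k \<in> {-pi..pi}"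
proof
  define r where "r = \<lfloor>(\<xi> + pi) / (2 * pi)\<rfloor>"
  have "of_int r \<le> (\<xi> + pi) / (2 * pi)" "(\<xi> + pi) / (2 * pi) < of_int r + 1" unfolding r_def by linarith+
  then show "\<xi> + 2 * pi * of_int (- r) \<in> {-pi..pi}" by (auto simp: field_simps)
qed

text \<open>An exponent above 1 makes periodizations converge locally uniformly and \<open>g\<close>
  integrable. The constant \<open>D\<close> is a parameter because multiplying \<open>g\<close> by a
  function of modulus 1 preserves it, so that all modulations of \<open>g\<close> share their
  bounds.\<close>

locale decaying =
  fixes g :: "real \<Rightarrow> 'a::euclidean_space" and \<sigma> D :: real
  assumes sigma: "\<sigma> > 1" and cont: "continuous_on UNIV g"
    and decay: "\<And>\<xi>. norm (g \<xi>) \<le> D * (1 + \<bar>\<xi>\<bar>) powr - \<sigma>"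
begin

lemma D_nonneg: "D \<ge> 0"
  using decay[of 0] norm_ge_zero[of "g 0"] by (simp del: norm_ge_zero)

lemma shift_bound:
  "norm (g (\<xi> + 2 * pi * of_int k)) \<le> D * (1 + \<bar>\<xi>\<bar>) powr \<sigma> * (1 + \<bar>of_int k\<bar>) powr - \<sigma>"
  using order_trans[OF decay mult_left_mono[OF powr_periodic_shift_le D_nonneg]] sigma
  by (simp add: mult.assoc)

lemma shift_bound_ball:
  assumes "\<bar>\<xi>\<bar> \<le> r"
  shows "norm (g (\<xi> + 2 * pi * of_int k)) \<le> D * (1 + r) powr \<sigma> * (1 + \<bar>of_int k\<bar>) powr - \<sigma>"
proof -
  have "(1 + \<bar>\<xi>\<bar>) powr \<sigma> \<le> (1 + r) powr \<sigma>" using assms sigma by (intro powr_mono2) auto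
  then show ?thesis
    using shift_bound[of \<xi> k] D_nonneg by (meson mult_left_mono mult_right_mono order_trans powr_ge_zero)
qed

lemma summable_shift_norm: "(\<lambda>k::int. norm (g (\<xi> + 2 * pi * of_int k))) summable_on UNIV"
  using summable_on_cmult_right[OF summable_on_int_powr[OF sigma]] shift_bound
  by (rule summable_on_comparison_test) auto

lemma summable_shift: "(\<lambda>k::int. g (\<xi> + 2 * pi * of_int k)) summable_on UNIV"
  using summable_shift_norm by (rule abs_summable_summable)

lemma periodization_uniform_limit:
  "uniform_limit {-r..r} (\<lambda>X \<xi>. \<Sum>k\<in>X. g (\<xi> + 2 * pi * of_int k)) (periodization g) (finite_subsets_at_top UNIV)"
  unfolding periodization_def
proof (rule Weierstrass_m_test_general)
  show "(\<lambda>k::int. D * (1 + r) powr \<sigma> * (1 + \<bar>of_int k\<bar>) powr - \<sigma>) summable_on UNIV"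
    by (intro summable_on_cmult_right summable_on_int_powr sigma)
qed (auto intro: shift_bound_ball)

lemma continuous_shift: "continuous_on S (\<lambda>\<xi>. g (\<xi> + c))"
  by (intro continuous_on_compose2[OF cont] continuous_intros) auto

lemma continuous_periodization: "continuous_on S (periodization g)"
proof -
  have "isCont (periodization g) \<xi>" for \<xi>
  proof -
    let ?r = "\<bar>\<xi>\<bar> + 1"
    have "continuous_on {- ?r..?r} (periodization g)"
      using periodization_uniform_limit[of ?r]
      by (rule uniform_limit_theorem[rotated]) (auto intro!: continuous_intros continuous_shift always_eventually)
    then show ?thesis by (rule continuous_on_interior) (auto simp: abs_if)
  qed
  then show ?thesis by (simp add: continuous_at_imp_continuous_on)
qed

text \<open>As the body mentions only \<open>\<sigma>\<close> and \<open>D\<close>, the constant is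
  the same for all modulations of \<open>g\<close>. This is the source of uniformity in
  \<open>t\<close>.\<close>

definition period_bound :: real where
  "period_bound = D * (1 + pi) powr \<sigma> * (\<Sum>\<^sub>\<infinity>k::int. (1 + \<bar>of_int k\<bar>) powr - \<sigma>)"

lemma periodization_bound:
  assumes "\<xi> \<in> {-pi..pi}"
  shows "norm (periodization g \<xi>) \<le> period_bound"
proof -
  have "norm (periodization g \<xi>) \<le> (\<Sum>\<^sub>\<infinity>k::int. norm (g (\<xi> + 2 * pi * of_int k)))"
    unfolding periodization_def by (rule norm_infsum_bound[OF summable_shift_norm])
  also have "\<dots> \<le> (\<Sum>\<^sub>\<infinity>k::int. D * (1 + pi) powr \<sigma> * (1 + \<bar>of_int k\<bar>) powr - \<sigma>)"
    using assms by (intro infsum_mono summable_shift_norm summable_on_cmult_right summable_on_int_powr sigma)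
      (auto intro: shift_bound_ball)
  also have "\<dots> = period_bound"
    unfolding period_bound_def by (rule infsum_cmult_right) (intro summable_on_int_powr sigma)
  finally show ?thesis .
qed

lemma integral_slices_tendsto:
  "(\<lambda>N. integral {-((2 * real N + 1) * pi)..(2 * real N + 1) * pi} g) \<longlonglongrightarrow> integral {-pi..pi} (periodization g)"
proof -
  have u: "uniform_limit {-pi..pi} (\<lambda>N \<xi>. \<Sum>k\<in>{-int N..int N}. g (\<xi> + 2 * pi * of_int k)) (periodization g) sequentially"
    using filterlim_compose[OF periodization_uniform_limit filterlim_symmetric_int_intervals] .
  have c: "continuous_on {-pi..pi} (\<lambda>\<xi>. \<Sum>k\<in>{-int N..int N}. g (\<xi> + 2 * pi * of_int k))" for N
    by (intro continuous_intros continuous_shift)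
  obtain I J where IJ:
    "\<And>N. ((\<lambda>\<xi>. \<Sum>k\<in>{-int N..int N}. g (\<xi> + 2 * pi * of_int k)) has_integral I N) {-pi..pi}"
    "(periodization g has_integral J) {-pi..pi}" "I \<longlonglongrightarrow> J"
    using uniform_limit_integral[OF u c sequentially_bot] by blast
  have "I = (\<lambda>N. integral {-((2 * real N + 1) * pi)..(2 * real N + 1) * pi} g)"
    by (simp only: integral_symmetric_slices[OF cont] integral_unique[OF IJ(1)])
  with IJ(2,3) show ?thesis by (simp add: integral_unique)
qed

lemma norm_decaying: "decaying (\<lambda>\<xi>. norm (g \<xi>)) \<sigma> D"
  using sigma cont decay by unfold_locales (auto intro: continuous_intros)

lemma slices_indicator_tendsto:
  fixes h :: "real \<Rightarrow> 'b::real_normed_vector"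
  shows "(\<lambda>N. if x \<in> {-((2 * real N + 1) * pi)..(2 * real N + 1) * pi} then h x else 0) \<longlonglongrightarrow> h x"
proof (rule tendsto_eventually)
  obtain N0 :: nat where N0: "\<bar>x\<bar> \<le> real N0" using real_arch_simple by blast
  have "x \<in> {-((2 * real N + 1) * pi)..(2 * real N + 1) * pi}" if "N \<ge> N0" for N
  proof -
    have "real N0 \<le> (2 * real N + 1) * 1" using that by simp
    also have "\<dots> \<le> (2 * real N + 1) * pi" using pi_ge_two by (intro mult_left_mono) auto
    finally show ?thesis using N0 by (simp only: atLeastAtMost_iff mult_minus_left) linarith
  qed
  then show "\<forall>\<^sub>F N in sequentially. (if x \<in> {-((2 * real N + 1) * pi)..(2 * real N + 1) * pi} then h x else 0) = h x"
    unfolding eventually_sequentially by auto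
qed

text \<open>Monotone convergence along the slices: their integrals converge to the integral of the
  periodized norm, hence are bounded. The result supplies the dominating function for
  \<open>g\<close> itself.\<close>

lemma norm_integrable: "(\<lambda>\<xi>. norm (g \<xi>)) integrable_on UNIV"
proof -
  define S where "S = (\<lambda>N. {-((2 * real N + 1) * pi)..(2 * real N + 1) * pi})"
  let ?f = "\<lambda>N x. if x \<in> S N then norm (g x) else 0"
  have mono: "S N \<subseteq> S (Suc N)" for N by (auto simp: S_def algebra_simps)
  have int: "(\<lambda>\<xi>. norm (g \<xi>)) integrable_on S N" for N
    unfolding S_def by (intro integrable_continuous_real continuous_intros continuous_on_subset[OF cont]) auto
  have "(\<lambda>N. integral (S N) (\<lambda>\<xi>. norm (g \<xi>))) \<longlonglongrightarrow> integral {-pi..pi} (periodization (\<lambda>\<xi>. norm (g \<xi>)))"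
    using decaying.integral_slices_tendsto[OF norm_decaying] by (simp add: S_def)
  then have bou: "bounded (range (\<lambda>N. integral UNIV (?f N)))"
    unfolding integral_restrict_UNIV by (intro convergent_imp_bounded) (auto simp: convergent_def)
  have mono': "?f N x \<le> ?f (Suc N) x" for N x using mono[of N] by auto
  have int': "?f N integrable_on UNIV" for N
    using int unfolding integrable_restrict_UNIV .
  have lim: "(\<lambda>N. ?f N x) \<longlonglongrightarrow> norm (g x)" for x
    using slices_indicator_tendsto[of x "\<lambda>\<xi>. norm (g \<xi>)"] unfolding S_def .
  show ?thesis
    using monotone_convergence_increasing[OF int' mono' lim bou] by (rule conjunct1)
qed

text \<open>The unfolding formula: the integral over the line equals the integral of the
  periodization over one period. Both claims come from dominated convergence along the
  slices.\<close>

lemma integrable: "g integrable_on UNIV"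
  and integral_eq_periodization: "integral UNIV g = integral {-pi..pi} (periodization g)"
proof -
  define S where "S = (\<lambda>N. {-((2 * real N + 1) * pi)..(2 * real N + 1) * pi})"
  let ?f = "\<lambda>N x. if x \<in> S N then g x else 0"
  have int: "g integrable_on S N" for N
    unfolding S_def by (intro integrable_continuous_real continuous_on_subset[OF cont]) auto
  have *: "?f N integrable_on UNIV" "norm (?f N x) \<le> norm (g x)" for N x
    using int by (auto simp: integrable_restrict_UNIV)
  have **: "(\<lambda>N. ?f N x) \<longlonglongrightarrow> g x" for x
    using slices_indicator_tendsto[of x g] by (simp only: S_def)
  show "g integrable_on UNIV"
    using dominated_convergence(1)[OF *(1) norm_integrable *(2) **] .
  have "(\<lambda>N. integral (S N) g) \<longlonglongrightarrow> integral UNIV g"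
    using dominated_convergence(2)[OF *(1) norm_integrable *(2) **] by (simp add: integral_restrict_UNIV)
  then show "integral UNIV g = integral {-pi..pi} (periodization g)"
    using integral_slices_tendsto LIMSEQ_unique unfolding S_def by blast
qed

end

section \<open>Inverse Fourier transform and Zak transform\<close>

definition inv_fourier :: "(real \<Rightarrow> complex) \<Rightarrow> real \<Rightarrow> complex" where
  "inv_fourier g t = integral UNIV (\<lambda>\<xi>. g \<xi> * cis (\<xi> * t)) / (2 * pi)"

definition zak :: "(real \<Rightarrow> complex) \<Rightarrow> real \<Rightarrow> real \<Rightarrow> complex" where
  "zak g t = periodization (\<lambda>\<xi>. g \<xi> * cis (\<xi> * t))"

context
  fixes g \<sigma> D
  assumes g: "decaying (g :: real \<Rightarrow> complex) \<sigma> D"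
begin

lemma decaying_modulate: "decaying (\<lambda>\<xi>. g \<xi> * cis (\<xi> * t)) \<sigma> D"
  using g unfolding decaying_def by (auto simp: norm_mult intro!: continuous_intros)

text \<open>After unfolding to one period, the factor \<open>cis (m * (\<xi> + 2 * pi * k))\<close>
  does not depend on the integer \<open>k\<close> and leaves the sum. All values on the coset of
  \<open>t\<close> are thus coefficients of one bounded continuous function.\<close>

lemma inv_fourier_eq_trig_coeff: "inv_fourier g (t + of_int m) = trig_coeff (zak g t) m"
proof -
  have "periodization (\<lambda>\<xi>. g \<xi> * cis (\<xi> * (t + of_int m))) \<xi> = zak g t \<xi> * cis (of_int m * \<xi>)" for \<xi>
  proof -
    have "cis ((\<xi> + 2 * pi * of_int k) * (t + of_int m)) =
      cis ((\<xi> + 2 * pi * of_int k) * t) * cis (of_int m * \<xi>) * cis (2 * pi * of_int (k * m))" for k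
      unfolding cis_mult by (rule arg_cong[of _ _ cis]) (simp add: algebra_simps)
    then have "periodization (\<lambda>\<xi>. g \<xi> * cis (\<xi> * (t + of_int m))) \<xi> =
      (\<Sum>\<^sub>\<infinity>k::int. g (\<xi> + 2 * pi * of_int k) * cis ((\<xi> + 2 * pi * of_int k) * t) * cis (of_int m * \<xi>))"
      unfolding periodization_def cis_of_int_2pi by (simp add: mult.assoc)
    also have "\<dots> = zak g t \<xi> * cis (of_int m * \<xi>)"
      unfolding zak_def periodization_def by (rule infsum_cmult_left')
    finally show ?thesis .
  qed
  then have "periodization (\<lambda>\<xi>. g \<xi> * cis (\<xi> * (t + of_int m))) = (\<lambda>\<xi>. zak g t \<xi> * cis (of_int m * \<xi>))"
    by (rule ext)
  then show ?thesis
    by (simp add: inv_fourier_def trig_coeff_def decaying.integral_eq_periodization[OF decaying_modulate])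
qed

lemma zak_continuous: "continuous_on S (zak g t)"
  unfolding zak_def by (rule decaying.continuous_periodization[OF decaying_modulate])

lemma zak_bound: "\<xi> \<in> {-pi..pi} \<Longrightarrow> cmod (zak g t \<xi>) \<le> decaying.period_bound \<sigma> D"
  unfolding zak_def by (rule decaying.periodization_bound[OF decaying_modulate])

lemma inv_fourier_integrable: "(\<lambda>\<xi>. g \<xi> * cis (\<xi> * t)) integrable_on UNIV"
  by (rule decaying.integrable[OF decaying_modulate])

end

section \<open>Cardinal interpolation in the scalar case\<close>

definition l2_tail :: "('a \<Rightarrow> complex) \<Rightarrow> 'a set \<Rightarrow> real" where
  "l2_tail c I = (\<Sum>\<^sub>\<infinity>k\<in>- I. (cmod (c k))\<^sup>2)"

lemma l2_tail_tendsto_0: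
  fixes c :: "int \<Rightarrow> complex"
  assumes c: "(\<lambda>k. (cmod (c k))\<^sup>2) summable_on UNIV"
  shows "(\<lambda>N. l2_tail c {- int N..int N}) \<longlonglongrightarrow> 0"
proof -
  let ?s = "\<Sum>\<^sub>\<infinity>k. (cmod (c k))\<^sup>2"
  have "l2_tail c {- int N..int N} = ?s - (\<Sum>k\<in>{- int N..int N}. (cmod (c k))\<^sup>2)" for N
    unfolding l2_tail_def Compl_eq_Diff_UNIV using c by (subst infsum_Diff) auto
  moreover have "(\<lambda>N. \<Sum>k\<in>{- int N..int N}. (cmod (c k))\<^sup>2) \<longlonglongrightarrow> ?s"
    using filterlim_compose[OF _ filterlim_symmetric_int_intervals] has_sum_infsum[OF c]
    unfolding has_sum_def .
  ultimately show ?thesis using tendsto_diff[OF tendsto_const, of _ ?s sequentially ?s] by simp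
qed

lemma sum_le_l2_tail:
  assumes c: "(\<lambda>k. (cmod (c k))\<^sup>2) summable_on UNIV" and "finite J" "J \<inter> I = {}"
  shows "(\<Sum>k\<in>J. (cmod (c k))\<^sup>2) \<le> l2_tail c I"
  unfolding l2_tail_def using assms summable_on_subset_banach[OF c]
  by (intro finite_sum_le_infsum) auto

lemma inv_fourier_convolution_le:
  assumes g: "decaying g \<sigma> D" and fin: "finite K" "finite I"
  shows "(\<Sum>m\<in>K. (cmod (\<Sum>k\<in>I. c k * inv_fourier g (t + of_int m - of_int k)))\<^sup>2)
    \<le> (decaying.period_bound \<sigma> D)\<^sup>2 * (\<Sum>k\<in>I. (cmod (c k))\<^sup>2)"
proof -
  have "inv_fourier g (t + of_int m - of_int k) = trig_coeff (zak g t) (m - k)" for m k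
    using inv_fourier_eq_trig_coeff[OF g, of t "m - k"] by (simp add: algebra_simps)
  then show ?thesis
    using trig_coeff_convolution_le[OF zak_continuous[OF g] zak_bound[OF g] fin] by simp
qed

text \<open>For every finite symmetric range containing \<open>I\<close> the convolution bound
  applies to the indices outside \<open>I\<close>, and their weight is at most the tail. Since
  \<open>K\<close> is finite, pointwise convergence at the points \<open>t + m\<close> suffices to
  pass to the limit.\<close>

lemma inv_fourier_series_remainder_le:
  assumes g: "decaying g \<sigma> D" and c: "(\<lambda>k. (cmod (c k))\<^sup>2) summable_on UNIV"
    and lim: "\<And>m. m \<in> K \<Longrightarrow>
      (\<lambda>N. \<Sum>k\<in>{- int N..int N}. c k * inv_fourier g (t + of_int m - of_int k)) \<longlonglongrightarrow> U m"
    and fin: "finite K" "finite I"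
  shows "(\<Sum>m\<in>K. (cmod (U m - (\<Sum>k\<in>I. c k * inv_fourier g (t + of_int m - of_int k))))\<^sup>2)
    \<le> (decaying.period_bound \<sigma> D)\<^sup>2 * l2_tail c I"
proof (rule tendsto_upperbound)
  let ?S = "\<lambda>I m. \<Sum>k\<in>I. c k * inv_fourier g (t + of_int m - of_int k)"
  show "(\<lambda>N. \<Sum>m\<in>K. (cmod (?S {- int N..int N} m - ?S I m))\<^sup>2)
     \<longlonglongrightarrow> (\<Sum>m\<in>K. (cmod (U m - ?S I m))\<^sup>2)"
    by (intro tendsto_intros lim)
  have "\<forall>\<^sub>F N in sequentially. finite {- int N..int N} \<and> I \<subseteq> {- int N..int N} \<and> {- int N..int N} \<subseteq> UNIV"
    using filterlim_symmetric_int_intervals fin(2) unfolding filterlim_finite_subsets_at_top by blast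
  then show "\<forall>\<^sub>F N in sequentially. (\<Sum>m\<in>K. (cmod (?S {- int N..int N} m - ?S I m))\<^sup>2)
      \<le> (decaying.period_bound \<sigma> D)\<^sup>2 * l2_tail c I"
  proof eventually_elim
    case (elim N)
    then have "?S {- int N..int N} m - ?S I m = ?S ({- int N..int N} - I) m" for m
      by (subst sum_diff) auto
    then have "(\<Sum>m\<in>K. (cmod (?S {- int N..int N} m - ?S I m))\<^sup>2)
      \<le> (decaying.period_bound \<sigma> D)\<^sup>2 * (\<Sum>k\<in>{- int N..int N} - I. (cmod (c k))\<^sup>2)"
      using inv_fourier_convolution_le[OF g fin(1), of "{- int N..int N} - I" c t] by simp
    also have "\<dots> \<le> (decaying.period_bound \<sigma> D)\<^sup>2 * l2_tail c I"
      by (intro mult_left_mono sum_le_l2_tail c) auto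
    finally show ?case .
  qed
qed simp

text \<open>Parseval for \<open>P\<close> and \<open>zak l t\<close>: the coefficients of
  \<open>P\<close> are the samples of the shifted \<open>inv_fourier g\<close>, those of
  \<open>zak l t\<close> are the values of \<open>inv_fourier l\<close> at \<open>t - k\<close>, and
  the product of the two functions is a modulated \<open>zak g t\<close>.\<close>

lemma cardinal_reproduction:
  assumes g: "decaying g \<sigma> D" and l: "decaying l \<sigma> D'"
    and lg: "\<And>\<xi>. l \<xi> * periodization g \<xi> = g \<xi>"
  shows "(\<lambda>N. \<Sum>k\<in>{- int N..int N}. inv_fourier g (of_int k - of_int j) * inv_fourier l (t - of_int k))
    \<longlonglongrightarrow> inv_fourier g (t - of_int j)"
proof -
  define P where "P = (\<lambda>\<xi>. cis (of_int (- j) * \<xi>) * zak g 0 \<xi>)"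
  have zak0: "zak g 0 = periodization g" by (simp add: zak_def)
  have "periodization g (-pi) = periodization g pi"
    using periodization_periodic[of g "-pi" 1] by simp
  moreover have "cis (of_int (- j) * pi) = cis (of_int (- j) * (- pi)) * cis (2 * pi * of_int (-j))"
    unfolding cis_mult by (rule arg_cong[of _ _ cis]) (simp add: algebra_simps)
  ultimately have per: "P (-pi) = P pi"
    unfolding P_def zak0 cis_of_int_2pi by simp
  have P: "continuous_on {-pi..pi} P"
    unfolding P_def by (intro continuous_intros zak_continuous[OF g])
  have coeff: "trig_coeff P k = inv_fourier g (of_int k - of_int j)" for k
    using inv_fourier_eq_trig_coeff[OF g, of 0 "k - j"] unfolding P_def trig_coeff_shift by simp
  have coeff': "trig_coeff (zak l t) (- k) = inv_fourier l (t - of_int k)" for k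
    using inv_fourier_eq_trig_coeff[OF l, of t "- k"] by simp
  \<comment> \<open>By periodicity \<open>periodization g\<close> may enter the sum, where it turns
    each value of \<open>l\<close> into one of \<open>g\<close>.\<close>
  have "zak l t \<xi> * zak g 0 \<xi> = zak g t \<xi>" for \<xi>
  proof -
    have "zak l t \<xi> * zak g 0 \<xi> =
      (\<Sum>\<^sub>\<infinity>k::int. l (\<xi> + 2 * pi * of_int k) * cis ((\<xi> + 2 * pi * of_int k) * t) * periodization g \<xi>)"
      unfolding zak0 unfolding zak_def periodization_def[of "\<lambda>\<xi>. l \<xi> * cis (\<xi> * t)"]
      by (rule infsum_cmult_left'[symmetric])
    also have "\<dots> = zak g t \<xi>"
      unfolding zak_def periodization_def[of "\<lambda>\<xi>. g \<xi> * cis (\<xi> * t)"]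
    proof (rule infsum_cong)
      fix k :: int
      have "l (\<xi> + 2 * pi * of_int k) * periodization g \<xi> = g (\<xi> + 2 * pi * of_int k)"
        using lg[of "\<xi> + 2 * pi * of_int k"] by (simp only: periodization_periodic)
      then show "l (\<xi> + 2 * pi * of_int k) * cis ((\<xi> + 2 * pi * of_int k) * t) * periodization g \<xi>
        = g (\<xi> + 2 * pi * of_int k) * cis ((\<xi> + 2 * pi * of_int k) * t)"
        by (simp only: mult.assoc mult.commute[of "cis _"])
           (simp only: mult.assoc[symmetric])
    qed
    finally show ?thesis .
  qed
  then have "(\<lambda>\<xi>. P \<xi> * zak l t \<xi>) = (\<lambda>\<xi>. cis (of_int (- j) * \<xi>) * zak g t \<xi>)"
    by (simp add: P_def mult.assoc mult.commute[of "zak g 0 _"])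
  then have "trig_coeff (\<lambda>\<xi>. P \<xi> * zak l t \<xi>) 0 = inv_fourier g (t - of_int j)"
    using inv_fourier_eq_trig_coeff[OF g, of t "- j"] by (simp only: trig_coeff_shift) simp
  then show ?thesis
    using Parseval_continuous[OF P per zak_continuous[OF l], of t] by (simp add: coeff coeff')
qed

text \<open>The interpolation series \<open>S\<close> of \<open>F\<close> is compared with that of
  the partial sums \<open>Fn\<close>, which are reproduced exactly. Once \<open>S\<close> is known
  to converge to \<open>F\<close> pointwise, the remainder estimate for \<open>l\<close> with the
  samples of \<open>F\<close> as coefficients gives a bound free of \<open>t\<close> and
  \<open>K\<close>.\<close>

theorem cardinal_series_remainder:
  assumes g: "decaying g \<sigma> D" and l: "decaying l \<sigma> D'"
    and lg: "\<And>\<xi>. l \<xi> * periodization g \<xi> = g \<xi>"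
    and a: "(\<lambda>k. (cmod (a k))\<^sup>2) summable_on UNIV"
    and lim: "\<And>x. (\<lambda>N. \<Sum>k\<in>{- int N..int N}. a k * inv_fourier g (x - of_int k)) \<longlonglongrightarrow> F x"
  obtains \<rho> where "\<rho> \<longlonglongrightarrow> 0"
    "\<And>t N K. finite K \<Longrightarrow> (\<Sum>m\<in>K. (cmod (F (t + of_int m) -
        (\<Sum>k\<in>{- int N..int N}. F (of_int k) * inv_fourier l (t + of_int m - of_int k))))\<^sup>2) \<le> \<rho> N"
proof -
  define B where "B = decaying.period_bound \<sigma> D"
  define B' where "B' = decaying.period_bound \<sigma> D'"
  define I where "I = (\<lambda>N. {- int N..int N})"
  have fI: "finite (I N)" for N by (simp add: I_def)
  define Fn where "Fn = (\<lambda>n x. \<Sum>k\<in>I n. a k * inv_fourier g (x - of_int k))"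
  define d where "d = (\<lambda>k. F (of_int k))"
  define S where "S = (\<lambda>N t. \<Sum>k\<in>I N. d k * inv_fourier l (t - of_int k))"
  define Sn where "Sn = (\<lambda>n N t. \<Sum>k\<in>I N. Fn n (of_int k) * inv_fourier l (t - of_int k))"
  have F_lim: "(\<lambda>n. Fn n x) \<longlonglongrightarrow> F x" for x using lim unfolding Fn_def I_def .
  have F_Fn: "(\<Sum>m\<in>K. (cmod (d m - Fn n (of_int m)))\<^sup>2) \<le> B\<^sup>2 * l2_tail a (I n)" if "finite K" for K n
    using inv_fourier_series_remainder_le[OF g a, of K 0 "\<lambda>m. F (of_int m)" "I n"] lim that fI
    by (simp add: d_def Fn_def B_def)
  have d: "(\<lambda>k. (cmod (d k))\<^sup>2) summable_on UNIV"
  \<comment> \<open>The remainder estimate with empty \<open>I\<close> bounds the samples of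
    \<open>F\<close> by the coefficients \<open>a\<close>.\<close>
  proof (rule nonneg_bdd_above_summable_on)
    have "(\<Sum>m\<in>K. (cmod (d m))\<^sup>2) \<le> B\<^sup>2 * l2_tail a {}" if "finite K" for K
      using inv_fourier_series_remainder_le[OF g a, of K 0 "\<lambda>m. F (of_int m)" "{}"] lim that
      by (simp add: d_def B_def)
    then show "bdd_above (sum (\<lambda>k. (cmod (d k))\<^sup>2) ` {F. F \<subseteq> UNIV \<and> finite F})"
      by (intro bdd_aboveI2) auto
  qed auto
  \<comment> \<open>\<open>Fn n\<close> is a finite combination of generators, so reproduction
    applies term by term.\<close>
  have Sn_lim: "(\<lambda>N. Sn n N t) \<longlonglongrightarrow> Fn n t" for n t
  proof -
    have "Sn n N t = (\<Sum>j\<in>I n. a j * (\<Sum>k\<in>I N. inv_fourier g (of_int k - of_int j) * inv_fourier l (t - of_int k)))" for N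
      unfolding Sn_def Fn_def sum_distrib_left sum_distrib_right
      by (subst sum.swap) (simp add: mult.assoc)
    then show ?thesis
      unfolding Fn_def I_def by (simp only:) (intro tendsto_intros cardinal_reproduction[OF g l lg])
  qed
  \<comment> \<open>The bound is independent of \<open>N\<close>, which justifies exchanging the
    limits in \<open>n\<close> and \<open>N\<close> below.\<close>
  have S_Sn: "(cmod (S N t - Sn n N t))\<^sup>2 \<le> B'\<^sup>2 * (B\<^sup>2 * l2_tail a (I n))" for N n t
  proof -
    have "S N t - Sn n N t = (\<Sum>k\<in>I N. (d k - Fn n (of_int k)) * inv_fourier l (t - of_int k))"
      by (simp add: S_def Sn_def left_diff_distrib sum_subtractf)
    then have "(cmod (S N t - Sn n N t))\<^sup>2 \<le> B'\<^sup>2 * (\<Sum>k\<in>I N. (cmod (d k - Fn n (of_int k)))\<^sup>2)"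
      using inv_fourier_convolution_le[OF l, of "{0}" "I N" "\<lambda>k. d k - Fn n (of_int k)" t] fI
      by (simp add: B'_def)
    also have "\<dots> \<le> B'\<^sup>2 * (B\<^sup>2 * l2_tail a (I n))"
      by (intro mult_left_mono F_Fn fI) auto
    finally show ?thesis .
  qed
  have S_lim: "(\<lambda>N. S N t) \<longlonglongrightarrow> F t" for t
  proof (rule metric_LIMSEQ_I)
    fix \<epsilon> :: real assume "\<epsilon> > 0"
    have "(\<lambda>n. B'\<^sup>2 * (B\<^sup>2 * l2_tail a (I n))) \<longlonglongrightarrow> 0"
      unfolding I_def by (intro tendsto_mult_right_zero l2_tail_tendsto_0 a)
    then have "\<forall>\<^sub>F n in sequentially. B'\<^sup>2 * (B\<^sup>2 * l2_tail a (I n)) < (\<epsilon> / 3)\<^sup>2"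
      using \<open>\<epsilon> > 0\<close> by (intro order_tendstoD) auto
    moreover have "\<forall>\<^sub>F n in sequentially. dist (Fn n t) (F t) < \<epsilon> / 3"
      using F_lim \<open>\<epsilon> > 0\<close> by (intro tendstoD) auto
    ultimately have "\<forall>\<^sub>F n in sequentially. B'\<^sup>2 * (B\<^sup>2 * l2_tail a (I n)) < (\<epsilon> / 3)\<^sup>2 \<and> dist (Fn n t) (F t) < \<epsilon> / 3"
      by (rule eventually_conj)
    then obtain n where n: "B'\<^sup>2 * (B\<^sup>2 * l2_tail a (I n)) < (\<epsilon> / 3)\<^sup>2" "dist (Fn n t) (F t) < \<epsilon> / 3"
      unfolding eventually_sequentially by blast
    have close: "cmod (S N t - Sn n N t) < \<epsilon> / 3" for N
      using le_less_trans[OF S_Sn n(1)] by (rule power2_less_imp_less) (use \<open>\<epsilon> > 0\<close> in simp)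
    have "\<forall>\<^sub>F N in sequentially. dist (Sn n N t) (Fn n t) < \<epsilon> / 3"
      using Sn_lim \<open>\<epsilon> > 0\<close> by (intro tendstoD) auto
    then obtain N0 where N0: "\<And>N. N \<ge> N0 \<Longrightarrow> dist (Sn n N t) (Fn n t) < \<epsilon> / 3"
      unfolding eventually_sequentially by blast
    have "dist (S N t) (F t) < \<epsilon>" if "N \<ge> N0" for N
    proof -
      have "dist (S N t) (F t) \<le> dist (S N t) (Sn n N t) + dist (Sn n N t) (Fn n t) + dist (Fn n t) (F t)"
        by (meson add_right_mono dist_triangle order_trans)
      also have "\<dots> < \<epsilon> / 3 + \<epsilon> / 3 + \<epsilon> / 3"
        using close[of N] N0[OF that] n(2) by (intro add_strict_mono) (auto simp: dist_norm)
      finally show ?thesis by simp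
    qed
    then show "\<exists>N0. \<forall>N\<ge>N0. dist (S N t) (F t) < \<epsilon>" by blast
  qed
  show ?thesis
  proof (rule that)
    \<comment> \<open>The rate is the tail of the samples \<open>d\<close> of \<open>F\<close>, not
      of the coefficients \<open>a\<close>.\<close>
    show "(\<lambda>N. B'\<^sup>2 * l2_tail d (I N)) \<longlonglongrightarrow> 0"
      unfolding I_def by (intro tendsto_mult_right_zero l2_tail_tendsto_0 d)
  next
    fix t :: real and N and K :: "int set" assume "finite K"
    then show "(\<Sum>m\<in>K. (cmod (F (t + of_int m) -
        (\<Sum>k\<in>{- int N..int N}. F (of_int k) * inv_fourier l (t + of_int m - of_int k))))\<^sup>2) \<le> B'\<^sup>2 * l2_tail d (I N)"
      using inv_fourier_series_remainder_le[OF l d, of K t "\<lambda>m. F (t + of_int m)" "I N"] fI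
        S_lim[unfolded S_def I_def]
      by (simp add: d_def B'_def I_def)
  qed
qed

section \<open>The function Xi, the Hurwitz zeta condition and fibre sums\<close>

lemma powr_divide_of_real:
  fixes z w :: complex
  assumes "x > 0" "z \<noteq> 0"
  shows "(z / of_real x) powr w = z powr w * of_real x powr (- w)"
proof -
  have L: "Ln (z / of_real x) = Ln z - Ln (of_real x)"
    using Ln_divide_of_real[OF assms] assms by (simp add: Ln_of_real)
  then show ?thesis
    using assms by (simp add: powr_def L exp_add[symmetric] right_diff_distrib)
qed

text \<open>Below the real axis the principal logarithm of \<open>- z\<close> is that of
  \<open>z\<close> plus \<open>\<i> * pi\<close>. This produces the exponential factor in front of
  the second Hurwitz zeta value.\<close>

lemma powr_minus_lower_half_plane:
  fixes z w :: complex
  assumes "Im z < 0"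
  shows "(- z) powr w = exp (\<i> * of_real pi * w) * z powr w"
proof -
  have "z \<noteq> 0" using assms by auto
  moreover from this have "Ln (- z) = Ln z + \<i> * pi" using assms by (simp add: Ln_minus)
  ultimately show ?thesis by (simp add: powr_def exp_add[symmetric] algebra_simps)
qed

text \<open>The modulus contains the factor \<open>exp (- Im w * Im (Ln z))\<close>, and the
  principal argument is at most \<open>pi\<close> in absolute value.\<close>

lemma norm_powr_complex_le:
  "cmod (z powr w) \<le> cmod z powr Re w * exp (pi * \<bar>Im w\<bar>)"
proof (cases "z = 0")
  case False
  have "- (Im w * Im (Ln z)) \<le> \<bar>Im (Ln z)\<bar> * \<bar>Im w\<bar>"
    by (metis abs_ge_minus_self abs_mult mult.commute)
  also have "\<dots> \<le> pi * \<bar>Im w\<bar>"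
    using Im_Ln_le_pi[OF False] mpi_less_Im_Ln[OF False] by (intro mult_right_mono) auto
  finally have "- (Im w * Im (Ln z)) \<le> pi * \<bar>Im w\<bar>" .
  then have "exp (Re w * ln (cmod z) - Im w * Im (Ln z)) \<le> exp (Re w * ln (cmod z) + pi * \<bar>Im w\<bar>)"
    by simp
  with False show ?thesis
    by (simp add: powr_def exp_add[symmetric])
qed simp

section \<open>Decay and continuity of Xi and its powers\<close>

lemma Xi_0 [simp]: "Xi 0 = 1"
  by (simp add: Xi_def)

lemma Xi_nonzero_arg: "\<xi> \<noteq> 0 \<Longrightarrow> Xi \<xi> = of_real (sin \<xi> / \<xi>) - \<i> * of_real ((1 - cos \<xi>) / \<xi>)"
  by (simp add: Xi_def complex_eq_iff Re_divide Im_divide exp_eq_polar field_simps power2_eq_square)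

lemma norm_Xi_le: "cmod (Xi \<xi>) \<le> 3 / (1 + \<bar>\<xi>\<bar>)"
proof (cases "\<xi> = 0")
  case False
  have "cmod (1 - exp (- \<i> * complex_of_real \<xi>)) = 2 * \<bar>sin (\<xi> / 2)\<bar>"
    using dist_exp_i_1[of "-\<xi>"] by (simp add: norm_minus_commute)
  then have Xi: "cmod (Xi \<xi>) = 2 * \<bar>sin (\<xi> / 2)\<bar> / \<bar>\<xi>\<bar>"
    using False by (simp add: Xi_def norm_divide norm_mult)
  have "\<bar>sin (\<xi> / 2)\<bar> \<le> \<bar>\<xi> / 2\<bar>" by (rule abs_sin_x_le_abs_x)
  moreover have "\<bar>sin (\<xi> / 2)\<bar> \<le> 1" by simp
  \<comment> \<open>The first bound is used for the summand 1 and the second for the summand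
    \<open>\<bar>\<xi>\<bar>\<close>, whence 3 = 1 + 2.\<close>
  ultimately have "2 * \<bar>sin (\<xi> / 2)\<bar> * (1 + \<bar>\<xi>\<bar>) \<le> 3 * \<bar>\<xi>\<bar>"
    using mult_right_mono[of "\<bar>sin (\<xi> / 2)\<bar>" 1 "\<bar>\<xi>\<bar>"] by (simp add: ring_distribs)
  then show ?thesis using False by (simp add: Xi divide_simps)
qed simp

text \<open>Vanishing of the imaginary part forces \<open>cos \<xi> = 1\<close> and hence
  \<open>sin \<xi> = 0\<close>. Thus \<open>Xi\<close> meets the branch cut of the principal power
  only in its zeros.\<close>

lemma Xi_nonpos_Reals:
  assumes "Xi \<xi> \<in> \<real>\<^sub>\<le>\<^sub>0"
  shows "Xi \<xi> = 0"
proof (cases "\<xi> = 0")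
  case False
  have "Im (Xi \<xi>) = 0" using assms by (simp add: complex_nonpos_Reals_iff)
  then have "cos \<xi> = 1" using False by (simp add: Xi_nonzero_arg)
  moreover from this have "sin \<xi> = 0" by (simp add: cos_one_sin_zero)
  ultimately show ?thesis using False by (simp add: Xi_nonzero_arg)
qed (use assms in \<open>simp add: complex_nonpos_Reals_iff\<close>)

lemma isCont_Xi: "isCont Xi \<xi>"
proof (cases "\<xi> = 0")
  case True
  have "((\<lambda>\<xi>. (exp (- \<i> * complex_of_real \<xi>) - 1) / (- \<i> * complex_of_real \<xi>)) \<longlongrightarrow> 1) (at 0)"
  proof (rule filterlim_compose[OF lim_exp_minus_1])
    have "((\<lambda>\<xi>. - \<i> * complex_of_real \<xi>) \<longlongrightarrow> - \<i> * complex_of_real 0) (at 0)"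
      by (intro tendsto_intros)
    then show "filterlim (\<lambda>\<xi>. - \<i> * complex_of_real \<xi>) (at 0) (at 0)"
      by (auto simp: filterlim_at eventually_at_filter)
  qed
  then have "(Xi \<longlongrightarrow> 1) (at 0)"
    by (rule Lim_transform_eventually) (auto simp: eventually_at_filter Xi_def field_simps)
  with True show ?thesis by (simp add: isCont_def)
next
  case False
  have "isCont (\<lambda>\<xi>. (1 - exp (- \<i> * complex_of_real \<xi>)) / (\<i> * complex_of_real \<xi>)) \<xi>"
    using False by (intro continuous_intros) auto
  moreover have "\<forall>\<^sub>F x in nhds \<xi>. (1 - exp (- \<i> * complex_of_real x)) / (\<i> * complex_of_real x) = Xi x"
    using t1_space_nhds[OF False] by (rule eventually_mono) (simp add: Xi_def)
  ultimately show ?thesis using isCont_cong by fast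
qed

text \<open>Away from zeros of \<open>Xi\<close> the branch cut is avoided; at a zero the modulus is
  squeezed by a positive power of the modulus of \<open>Xi\<close>.\<close>

lemma isCont_Xi_powr:
  assumes "Re w > 0"
  shows "isCont (\<lambda>\<xi>. Xi \<xi> powr w) \<xi>"
proof (cases "Xi \<xi> = 0")
  case False
  then show ?thesis
    using Xi_nonpos_Reals[of \<xi>] isCont_Xi by (intro continuous_intros) auto
next
  case True
  have "isCont (\<lambda>x. cmod (Xi x)) \<xi>" by (intro continuous_intros isCont_Xi)
  then have "((\<lambda>x. cmod (Xi x)) \<longlongrightarrow> 0) (at \<xi>)" using True by (simp add: isCont_def)
  then have "((\<lambda>x. cmod (Xi x) powr Re w) \<longlongrightarrow> 0 powr Re w) (at \<xi>)"
    using assms by (intro tendsto_powr') auto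
  then have "((\<lambda>x. cmod (Xi x) powr Re w * exp (pi * \<bar>Im w\<bar>)) \<longlongrightarrow> 0) (at \<xi>)"
    by (intro tendsto_mult_left_zero) simp
  then have "((\<lambda>x. Xi x powr w) \<longlongrightarrow> 0) (at \<xi>)"
    by (rule Lim_null_comparison[rotated]) (simp add: norm_powr_complex_le always_eventually)
  then show ?thesis using True by (simp add: isCont_def)
qed

lemma decaying_Xi_powr:
  assumes "Re w > 1"
  shows "decaying (\<lambda>\<xi>. Xi \<xi> powr w) (Re w) (3 powr Re w * exp (pi * \<bar>Im w\<bar>))"
proof
  show "continuous_on UNIV (\<lambda>\<xi>. Xi \<xi> powr w)"
    using isCont_Xi_powr[of w] assms by (simp add: continuous_at_imp_continuous_on)
  fix \<xi>
  have "cmod (Xi \<xi> powr w) \<le> cmod (Xi \<xi>) powr Re w * exp (pi * \<bar>Im w\<bar>)"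
    by (rule norm_powr_complex_le)
  also have "\<dots> \<le> (3 / (1 + \<bar>\<xi>\<bar>)) powr Re w * exp (pi * \<bar>Im w\<bar>)"
    using assms by (intro mult_right_mono powr_mono2 norm_Xi_le) auto
  also have "\<dots> = 3 powr Re w * exp (pi * \<bar>Im w\<bar>) * (1 + \<bar>\<xi>\<bar>) powr - Re w"
    by (simp add: powr_divide powr_minus field_simps)
  finally show "cmod (Xi \<xi> powr w) \<le> \<dots>" .
qed (use assms in simp)

section \<open>Periodized powers of Xi and the Hurwitz zeta function\<close>

lemma periodization_Xi_powr_0: "periodization (\<lambda>\<xi>. Xi \<xi> powr w) 0 = 1"
proof -
  \<comment> \<open>Only the term \<open>k = 0\<close> survives. This treats the multiples of
    \<open>2 * pi\<close>, which lie outside the range of the zeta condition.\<close>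
  have "Xi (2 * pi * of_int k) = 0" if "k \<noteq> 0" for k
    using that cos_int_2pin[of k] sin_int_2pin[of k] by (subst Xi_nonzero_arg) (auto simp: mult_ac)
  then have "periodization (\<lambda>\<xi>. Xi \<xi> powr w) 0 = (\<Sum>\<^sub>\<infinity>k\<in>{0::int}. Xi (0 + 2 * pi * of_int k) powr w)"
    unfolding periodization_def by (intro infsum_cong_neutral) auto
  then show ?thesis by simp
qed

text \<open>The numerator of \<open>Xi\<close> has period \<open>2 * pi\<close>, so on the coset of
  \<open>2 * pi * \<alpha>\<close> the values of \<open>Xi\<close> are
  \<open>C / (\<alpha> + k)\<close>. Indices \<open>k \<ge> 0\<close> sum to the zeta value at
  \<open>\<alpha>\<close>, negative ones to that at \<open>1 - \<alpha>\<close>.\<close>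

lemma periodization_Xi_powr_hurwitz:
  assumes w: "Re w > 1" and \<alpha>: "0 < \<alpha>" "\<alpha> < 1"
  obtains C where "C \<noteq> 0" "periodization (\<lambda>\<xi>. Xi \<xi> powr w) (2 * pi * \<alpha>) =
    C powr w * (hurwitz_zeta w \<alpha> + exp (\<i> * of_real pi * w) * hurwitz_zeta w (1 - \<alpha>))"
proof -
  define C where "C = (1 - exp (- \<i> * complex_of_real (2 * pi * \<alpha>))) / (\<i> * of_real (2 * pi))"
  have "cos (2 * pi * \<alpha>) \<noteq> 1"
  proof
    assume "cos (2 * pi * \<alpha>) = 1"
    then obtain n :: int where "2 * pi * \<alpha> = of_int n * 2 * pi" using cos_one_2pi_int by blast
    then have "\<alpha> = of_int n" by simp
    with \<alpha> show False by auto
  qed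
  then have "cos (2 * pi * \<alpha>) < 1" using cos_le_one[of "2 * pi * \<alpha>"] by linarith
  \<comment> \<open>That \<open>C\<close> lies in the lower half-plane decides the sign in the
    exponential factor.\<close>
  moreover have "Im C = - (1 - cos (2 * pi * \<alpha>)) / (2 * pi)"
    by (simp add: C_def Im_divide exp_eq_polar power2_eq_square field_simps)
  ultimately have ImC: "Im C < 0" by (simp add: divide_neg_pos)
  then have C0: "C \<noteq> 0" by auto
  have Xi: "Xi (2 * pi * \<alpha> + 2 * pi * of_int k) = C / of_real (\<alpha> + of_int k)" for k
  proof -
    have "\<alpha> + of_int k \<noteq> 0" 
    proof
      assume "\<alpha> + of_int k = 0"
      then have "\<alpha> = of_int (- k)" by simp
      with \<alpha> show False by simp
    qed
    then have "2 * pi * \<alpha> + 2 * pi * of_int k \<noteq> 0" by (simp flip: distrib_left)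
    moreover have "exp (- \<i> * complex_of_real (2 * pi * \<alpha> + 2 * pi * of_int k)) = exp (- \<i> * complex_of_real (2 * pi * \<alpha>))"
      using cis_of_int_2pi[of "-k"]
      by (simp add: cis_conv_exp ring_distribs exp_add exp_diff mult_ac)
    ultimately show ?thesis by (simp add: Xi_def C_def field_simps)
  qed
  let ?g = "\<lambda>k::int. Xi (2 * pi * \<alpha> + 2 * pi * of_int k) powr w"
  have sm: "?g summable_on A" for A
    using decaying.summable_shift[OF decaying_Xi_powr[OF w]] summable_on_subset_banach by blast
  \<comment> \<open>Common treatment of both halves of the integers: \<open>h\<close> enumerates a
    half on which the terms are those of a Hurwitz series up to the factor \<open>c\<close>.\<close>
  have part: "infsum ?g (range h) = c * hurwitz_zeta w \<beta>"
    if h: "inj h" "\<And>n. ?g (h n) = c * of_real (\<beta> + real n) powr (- w)" "c \<noteq> 0" for h :: "nat \<Rightarrow> int" and c \<beta>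
  proof -
    have "infsum ?g (range h) = infsum (\<lambda>n. ?g (h n)) UNIV"
      using h by (subst infsum_reindex) (auto simp: o_def)
    also have "\<dots> = (\<Sum>\<^sub>\<infinity>n. c * of_real (\<beta> + real n) powr (- w))" by (simp only: h)
    also have "\<dots> = c * (\<Sum>\<^sub>\<infinity>n. of_real (\<beta> + real n) powr (- w))" by (rule infsum_cmult_right')
    also have "(\<lambda>n. of_real (\<beta> + real n) powr (- w)) summable_on UNIV"
    proof -
      have "(\<lambda>n. ?g (h n)) summable_on UNIV"
        using sm[of "range h"] h(1) by (subst (asm) summable_on_reindex) (auto simp: o_def)
      then show ?thesis using h(2,3) by (simp add: summable_on_cmult_right')
    qed
    then have "(\<Sum>\<^sub>\<infinity>n. of_real (\<beta> + real n) powr (- w)) = hurwitz_zeta w \<beta>"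
      unfolding hurwitz_zeta_def
      by (metis has_sum_infsum has_sum_imp_sums sums_unique)
    finally show ?thesis .
  qed
  have Cw: "C powr w \<noteq> 0" using C0 by simp
  have pos: "infsum ?g (range int) = C powr w * hurwitz_zeta w \<alpha>"
  proof (rule part)
    fix n
    show "?g (int n) = C powr w * of_real (\<alpha> + real n) powr (- w)"
      unfolding Xi using \<alpha> C0 powr_divide_of_real[of "\<alpha> + real n" C w] by simp
  qed (use Cw in auto)
  \<comment> \<open>For \<open>k = - 1 - n\<close> the denominator \<open>\<alpha> + k\<close> is
    \<open>- (1 - \<alpha> + n)\<close>; the minus sign is moved to \<open>C\<close>.\<close>
  have neg: "infsum ?g (range (\<lambda>n. - 1 - int n)) = (exp (\<i> * of_real pi * w) * C powr w) * hurwitz_zeta w (1 - \<alpha>)"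
  proof (rule part)
    fix n
    have "Xi (2 * pi * \<alpha> + 2 * pi * of_int (- 1 - int n)) = (- C) / of_real (1 - \<alpha> + real n)"
      unfolding Xi by (simp add: divide_simps) (simp add: algebra_simps)
    then show "?g (- 1 - int n) = (exp (\<i> * of_real pi * w) * C powr w) * of_real (1 - \<alpha> + real n) powr (- w)"
      using \<alpha> C0 powr_divide_of_real[of "1 - \<alpha> + real n" "- C" w]
      by (simp only: powr_minus_lower_half_plane[OF ImC]) simp
  qed (use Cw in \<open>auto simp: inj_on_def\<close>)
  have "range int \<union> range (\<lambda>n. - 1 - int n) = UNIV"
  proof -
    have "k \<in> range int \<union> range (\<lambda>n. - 1 - int n)" for k
      by (cases "k \<ge> 0") (auto simp: image_iff intro: exI[of _ "nat k"] exI[of _ "nat (- 1 - k)"])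
    then show ?thesis by blast
  qed
  then have "periodization (\<lambda>\<xi>. Xi \<xi> powr w) (2 * pi * \<alpha>) = infsum ?g (range int \<union> range (\<lambda>n. - 1 - int n))"
    by (simp add: periodization_def)
  also have "\<dots> = C powr w * (hurwitz_zeta w \<alpha> + exp (\<i> * of_real pi * w) * hurwitz_zeta w (1 - \<alpha>))"
    using pos neg by (subst infsum_Un_disjoint) (auto simp: sm ring_distribs)
  finally show ?thesis using that C0 by blast
qed

lemma periodization_Xi_powr_nonzero:
  assumes w: "Re w > 1"
    and hz: "\<And>\<alpha>::real. 0 < \<alpha> \<Longrightarrow> \<alpha> < 1 \<Longrightarrow>
      hurwitz_zeta w \<alpha> + exp (- \<i> * of_real pi * w) * hurwitz_zeta w (1 - \<alpha>) \<noteq> 0"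
  shows "periodization (\<lambda>\<xi>. Xi \<xi> powr w) \<xi> \<noteq> 0"
proof -
  define \<alpha> where "\<alpha> = frac (\<xi> / (2 * pi))"
  have "\<xi> = 2 * pi * \<alpha> + 2 * pi * of_int \<lfloor>\<xi> / (2 * pi)\<rfloor>"
    by (simp add: \<alpha>_def frac_def field_simps)
  then have eq: "periodization (\<lambda>\<xi>. Xi \<xi> powr w) \<xi> = periodization (\<lambda>\<xi>. Xi \<xi> powr w) (2 * pi * \<alpha>)"
    using periodization_periodic by metis
  show ?thesis
  proof (cases "\<alpha> = 0")
    case True then show ?thesis using eq periodization_Xi_powr_0 by simp
  next
    case False
    then have \<alpha>: "0 < \<alpha>" "\<alpha> < 1" using frac_ge_0[of "\<xi> / (2 * pi)"] frac_lt_1[of "\<xi> / (2 * pi)"]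
      by (auto simp: \<alpha>_def simp del: frac_ge_0)
    \<comment> \<open>The sign of the exponent is opposite to that in the hypothesis. Factoring out
      the exponential yields the hypothesis at \<open>1 - \<alpha>\<close>.\<close>
    have "hurwitz_zeta w \<alpha> + exp (\<i> * of_real pi * w) * hurwitz_zeta w (1 - \<alpha>) =
      exp (\<i> * of_real pi * w) * (hurwitz_zeta w (1 - \<alpha>) + exp (- \<i> * of_real pi * w) * hurwitz_zeta w (1 - (1 - \<alpha>)))"
      by (simp add: ring_distribs exp_add[symmetric] mult.assoc[symmetric])
    then show ?thesis
      using periodization_Xi_powr_hurwitz[OF w \<alpha>] hz[of "1 - \<alpha>"] \<alpha> eq
      by (metis diff_gt_0_iff_gt diff_less_eq less_add_same_cancel1 exp_not_eq_zero mult_eq_0_iff powr_eq_0_iff)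
  qed
qed

text \<open>A continuous periodic function without zeros is bounded away from 0, so the quotient
  decays at the same rate as \<open>g\<close>.\<close>

lemma decaying_divide_periodization:
  fixes g :: "real \<Rightarrow> complex"
  assumes g: "decaying g \<sigma> D" and nz: "\<And>\<xi>. periodization g \<xi> \<noteq> 0"
  obtains D' where "decaying (\<lambda>\<xi>. g \<xi> / periodization g \<xi>) \<sigma> D'"
proof -
  have c: "continuous_on S (periodization g)" for S by (rule decaying.continuous_periodization[OF g])
  have "continuous_on {-pi..pi} (\<lambda>\<xi>. cmod (periodization g \<xi>))" by (intro continuous_intros c)
  then obtain \<xi>0 where \<xi>0: "\<And>\<xi>. \<xi> \<in> {-pi..pi} \<Longrightarrow> cmod (periodization g \<xi>0) \<le> cmod (periodization g \<xi>)"
    using continuous_attains_inf[of "{-pi..pi}" "\<lambda>\<xi>. cmod (periodization g \<xi>)"] pi_ge_zero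
    by (metis atLeastatMost_empty_iff compact_Icc order.trans neg_le_0_iff_le)
  define m where "m = cmod (periodization g \<xi>0)"
  have m: "m > 0" using nz by (simp add: m_def)
  have lower: "m \<le> cmod (periodization g \<xi>)" for \<xi>
    using real_mod_2pi[of \<xi>] \<xi>0 periodization_periodic[of g \<xi>] unfolding m_def by metis
  have "decaying (\<lambda>\<xi>. g \<xi> / periodization g \<xi>) \<sigma> (D / m)"
  proof
    show "continuous_on UNIV (\<lambda>\<xi>. g \<xi> / periodization g \<xi>)"
      using decaying.cont[OF g] c nz by (intro continuous_intros) auto
    fix \<xi>
    have "cmod (g \<xi> / periodization g \<xi>) \<le> (D * (1 + \<bar>\<xi>\<bar>) powr - \<sigma>) / m"
      unfolding norm_divide using decaying.decay[OF g] lower m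
      by (intro frac_le) (auto intro: order_trans[OF norm_ge_zero])
    then show "cmod (g \<xi> / periodization g \<xi>) \<le> D / m * (1 + \<bar>\<xi>\<bar>) powr - \<sigma>" by simp
  qed (use decaying.sigma[OF g] in simp)
  then show ?thesis by (rule that)
qed

text \<open>The line is cut into unit intervals, all moved to one, where the integrand is a sum over
  a coset of the integers. The argument runs over simple functions below \<open>u\<close>, which are
  measurable whatever \<open>u\<close> is, and the supremum is taken at the end.\<close>

lemma nn_integral_le_fiber_sums:
  fixes u :: "real \<Rightarrow> ennreal"
  assumes u: "\<And>t K. finite K \<Longrightarrow> (\<Sum>m\<in>K. u (t + of_int m)) \<le> r"
  shows "(\<integral>\<^sup>+ t. u t \<partial>lborel) \<le> r"
  unfolding nn_integral_def
proof (rule SUP_least)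
  fix s assume s: "s \<in> {g. simple_function lborel g \<and> g \<le> u}"
  then have [measurable]: "s \<in> borel_measurable lborel"
    using borel_measurable_simple_function[of lborel s] by auto
  \<comment> \<open>The integers are enumerated by \<open>int_decode\<close> because countable
    additivity is stated for families indexed by naturals.\<close>
  define B where "B = (\<lambda>n. {real_of_int (int_decode n)..<real_of_int (int_decode n) + 1})"
  have disj: "disjoint_family B"
    unfolding disjoint_family_on_def
  proof (intro ballI impI)
    fix m n :: nat assume "m \<noteq> n"
    have "x \<notin> B m \<inter> B n" for x
    proof
      assume "x \<in> B m \<inter> B n"
      then have "\<lfloor>x\<rfloor> = int_decode m" "\<lfloor>x\<rfloor> = int_decode n" by (auto simp: B_def floor_eq_iff)
      with \<open>m \<noteq> n\<close> show False by (metis int_decode_inverse)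
    qed
    then show "B m \<inter> B n = {}" by blast
  qed
  have un: "(\<Union>n. B n) = space lborel"
  proof -
    have "x \<in> B (int_encode \<lfloor>x\<rfloor>)" for x by (simp add: B_def)
    then show ?thesis by auto
  qed
  have "simple_integral lborel s = (\<integral>\<^sup>+ t. s t \<partial>lborel)"
    using s by (simp add: nn_integral_eq_simple_integral)
  also have "\<dots> = (\<integral>\<^sup>+ t \<in> (\<Union>n. B n). s t \<partial>lborel)" by (simp add: un)
  also have "\<dots> = (\<Sum>n. \<integral>\<^sup>+ t. s t * indicator (B n) t \<partial>lborel)"
    using disj by (intro nn_integral_disjoint_family) (auto simp: B_def)
  also have "\<dots> \<le> r"
  proof (rule suminf_le_const)
    fix N
    have "(\<Sum>n<N. \<integral>\<^sup>+ t. s t * indicator (B n) t \<partial>lborel) =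
        (\<Sum>n<N. \<integral>\<^sup>+ t. s (t + of_int (int_decode n)) * indicator {0..<1} t \<partial>lborel)"
    proof (rule sum.cong[OF refl])
      fix n
      have "(\<integral>\<^sup>+ t. s t * indicator (B n) t \<partial>lborel) = 
        (\<integral>\<^sup>+ t. s (of_int (int_decode n) + t) * indicator (B n) (of_int (int_decode n) + t) \<partial>lborel)"
        by (subst nn_integral_real_affine[where c = 1 and t = "of_int (int_decode n)"]) (auto simp: B_def)
      also have "\<dots> = (\<integral>\<^sup>+ t. s (t + of_int (int_decode n)) * indicator {0..<1} t \<partial>lborel)"
        by (intro nn_integral_cong) (auto simp: B_def indicator_def add.commute)
      finally show "(\<integral>\<^sup>+ t. s t * indicator (B n) t \<partial>lborel) = \<dots>" .
    qed
    also have "\<dots> = (\<integral>\<^sup>+ t. (\<Sum>n<N. s (t + of_int (int_decode n)) * indicator {0..<1} t) \<partial>lborel)"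
      by (rule nn_integral_sum[symmetric]) measurable
    also have "\<dots> \<le> (\<integral>\<^sup>+ t. r * indicator {0..<1::real} t \<partial>lborel)"
    proof (rule nn_integral_mono)
      fix t :: real
      have "(\<Sum>n<N. s (t + of_int (int_decode n))) \<le> (\<Sum>n<N. u (t + of_int (int_decode n)))"
        using s by (intro sum_mono) (auto simp: le_fun_def)
      also have "\<dots> = (\<Sum>m\<in>int_decode ` {..<N}. u (t + of_int m))"
        by (subst sum.reindex) (auto intro: inj_on_subset[OF inj_int_decode])
      also have "\<dots> \<le> r" by (rule u) simp
      finally show "(\<Sum>n<N. s (t + of_int (int_decode n)) * indicator {0..<1} t) \<le> r * indicator {0..<1::real} t"
        by (simp add: indicator_def)
    qed
    also have "\<dots> = r" by (simp add: nn_integral_cmult)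
    finally show "(\<Sum>n<N. \<integral>\<^sup>+ t. s t * indicator (B n) t \<partial>lborel) \<le> r" .
  qed auto
  finally show "simple_integral lborel s \<le> r" .
qed

section \<open>Reduction of quaternion-valued series to scalar ones\<close>

lemma hq_nth [simp]: "hq a b c d $ 0 = a" "hq a b c d $ 1 = b" "hq a b c d $ 2 = c" "hq a b c d $ 3 = d"
  by (simp_all add: hq_def)

lemma UNIV_index4: "(UNIV :: 4 set) = {0, 1, 2, 3}"
proof -
  have "(4 :: 4) = 0" by simp
  with UNIV_4 show ?thesis by auto
qed

lemma hqc_eq_iff: "x = y \<longleftrightarrow> x $ 0 = y $ 0 \<and> x $ 1 = y $ 1 \<and> x $ 2 = y $ 2 \<and> x $ 3 = y $ 3"
  for x y :: "'a ^ 4"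
proof -
  have "x = y \<longleftrightarrow> (\<forall>i\<in>UNIV. x $ i = y $ i)" by (simp add: vec_eq_iff)
  then show ?thesis unfolding UNIV_index4 by simp
qed

lemma cscale_nth [simp]: "cscale c x $ j = c * x $ j"
  by (simp add: cscale_def)

lemma qmult_nth:
  "qmult p q $ 0 = p$0*q$0 - p$1*q$1 - p$2*q$2 - p$3*q$3"
  "qmult p q $ 1 = p$0*q$1 + p$1*q$0 + p$2*q$3 - p$3*q$2"
  "qmult p q $ 2 = p$0*q$2 - p$1*q$3 + p$2*q$0 + p$3*q$1"
  "qmult p q $ 3 = p$0*q$3 + p$1*q$2 - p$2*q$1 + p$3*q$0"
  by (simp_all add: qmult_def)

lemma qmult_assoc: "qmult (qmult a b) c = qmult a (qmult b c)"
  by (simp add: hqc_eq_iff qmult_nth algebra_simps)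

lemma qmult_cscale_right: "qmult a (cscale c b) = cscale c (qmult a b)"
  by (simp add: hqc_eq_iff qmult_nth algebra_simps)

lemma bounded_linear_qmult_left: "bounded_linear (\<lambda>a. qmult a b)"
  by (intro linear_conv_bounded_linear[THEN iffD1] linearI)
     (simp_all add: hqc_eq_iff qmult_nth algebra_simps)

lemma qmult_add_right: "qmult a (b + c) = qmult a b + qmult a c"
  by (simp add: hqc_eq_iff qmult_nth algebra_simps)

lemma bounded_linear_cscale_left: "bounded_linear (\<lambda>c. cscale c x)"
  by (intro linear_conv_bounded_linear[THEN iffD1] linearI)
     (simp_all add: hqc_eq_iff algebra_simps)

lemma cscale_add_right: "cscale c (x + y) = cscale c x + cscale c y"
  by (simp add: hqc_eq_iff algebra_simps)

lemma cscale_cscale: "cscale c (cscale d x) = cscale (c * d) x"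
  by (simp add: hqc_eq_iff)

text \<open>For a unit vector \<open>u\<close> the commutative algebra generated by \<open>u\<close> is
  \<open>\<complex> \<times> \<complex>\<close>, because \<open>u\<close> has eigenvalues \<open>\<i>\<close> and \<open>- \<i>\<close>: \<open>qdiag u a b\<close> is the element
  with eigenvalues \<open>a\<close> and \<open>b\<close>, that is, \<open>(a + b) / 2 + u (a - b) / (2 \<i>)\<close>.\<close>
definition qdiag :: "hqr \<Rightarrow> complex \<Rightarrow> complex \<Rightarrow> hqc" where
  "qdiag u a b = (let d = (a - b) / (2 * \<i>) in hq ((a + b) / 2) (d * u$1) (d * u$2) (d * u$3))"

lemma qdiag_decompose: "qdiag u a b = cscale a (qdiag u 1 0) + cscale b (qdiag u 0 1)"
  by (simp add: qdiag_def hqc_eq_iff Let_def field_simps)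

lemma qdiag_one: "qmult x (qdiag u 1 1) = x"
  by (simp add: qdiag_def hqc_eq_iff qmult_nth Let_def)

context
  fixes u :: hqr
  assumes u: "(u$1)\<^sup>2 + (u$2)\<^sup>2 + (u$3)\<^sup>2 = 1"
begin

lemma u_squares: "(complex_of_real (u$1))\<^sup>2 = 1 - (complex_of_real (u$2))\<^sup>2 - (complex_of_real (u$3))\<^sup>2"
proof -
  have "(u$1)\<^sup>2 = 1 - (u$2)\<^sup>2 - (u$3)\<^sup>2" using u by simp
  from arg_cong[OF this, of complex_of_real] show ?thesis by simp
qed

text \<open>Both vector parts are multiples of \<open>u\<close>, so the cross product terms cancel,
  and \<open>u\<close> squares to -1.\<close>

lemma qmult_qdiag: "qmult (qdiag u a b) (qdiag u c d) = qdiag u (a * c) (b * d)"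
proof -
  define x y z where "x = complex_of_real (u$1)" and "y = complex_of_real (u$2)" and "z = complex_of_real (u$3)"
  have x: "x * x = 1 - y * y - z * z" using u_squares by (simp add: x_def y_def z_def power2_eq_square)
  define e f h where "e = (a - b) / (2 * \<i>)" and "f = (c - d) / (2 * \<i>)"
    and "h = (a * c - b * d) / (2 * \<i>)"
  define A B where "A = (a + b) / 2" and "B = (c + d) / 2"
  have Q: "qdiag u a b = hq A (e * x) (e * y) (e * z)" "qdiag u c d = hq B (f * x) (f * y) (f * z)"
    "qdiag u (a * c) (b * d) = hq ((a * c + b * d) / 2) (h * x) (h * y) (h * z)"
    unfolding qdiag_def Let_def A_def B_def e_def f_def h_def x_def y_def z_def by (rule refl)+
  have "A * B - e * x * (f * x) - e * y * (f * y) - e * z * (f * z) = A * B - e * f * (x * x + y * y + z * z)"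
    by (simp add: algebra_simps)
  also have "\<dots> = (a * c + b * d) / 2"
    unfolding x by (simp add: A_def B_def e_def f_def field_simps)
  finally have 0: "A * B - e * x * (f * x) - e * y * (f * y) - e * z * (f * z) = (a * c + b * d) / 2" .
  have h: "h = A * f + e * B"
    by (simp add: A_def B_def e_def f_def h_def field_simps)
  show ?thesis
    unfolding Q qmult_def hq_nth 0 h by (simp add: algebra_simps)
qed

text \<open>The sum of squares in \<open>qinv\<close> is the product \<open>a * b\<close> of the
  eigenvalues.\<close>

lemma qinv_qdiag:
  assumes "a \<noteq> 0" "b \<noteq> 0"
  shows "qinv (qdiag u a b) = qdiag u (1 / a) (1 / b)"
proof -
  define x y z where "x = complex_of_real (u$1)" and "y = complex_of_real (u$2)" and "z = complex_of_real (u$3)"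
  have x: "x\<^sup>2 = 1 - y\<^sup>2 - z\<^sup>2" using u_squares by (simp add: x_def y_def z_def)
  define e where "e = (a - b) / (2 * \<i>)"
  have e2: "e\<^sup>2 = - ((a - b)\<^sup>2) / 4" by (simp add: e_def power_divide power_mult_distrib)
  have n: "((a + b) / 2)\<^sup>2 + (e * x)\<^sup>2 + (e * y)\<^sup>2 + (e * z)\<^sup>2 = a * b"
  proof -
    have "((a + b) / 2)\<^sup>2 + (e * x)\<^sup>2 + (e * y)\<^sup>2 + (e * z)\<^sup>2 = ((a + b) / 2)\<^sup>2 + e\<^sup>2 * (x\<^sup>2 + y\<^sup>2 + z\<^sup>2)"
      by (simp add: power_mult_distrib algebra_simps)
    also have "\<dots> = a * b" unfolding x e2 by (simp add: power2_eq_square field_simps)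
    finally show ?thesis .
  qed
  have v: "- (e * v) / (a * b) = (1 / a - 1 / b) / (2 * \<i>) * v" for v
    using assms by (simp add: e_def field_simps)
  have r: "(a + b) / 2 / (a * b) = (1 / a + 1 / b) / 2" using assms by (simp add: field_simps)
  have "qdiag u a b = hq ((a + b) / 2) (e * x) (e * y) (e * z)"
    unfolding qdiag_def Let_def e_def x_def y_def z_def ..
  then have "qinv (qdiag u a b) = hq ((a + b) / 2 / (a * b)) (- (e * x) / (a * b)) (- (e * y) / (a * b)) (- (e * z) / (a * b))"
    by (simp only: qinv_def Let_def hq_nth n)
  then show ?thesis
    unfolding v r qdiag_def Let_def x_def y_def z_def .
qed

end

section \<open>Diagonal form of the quaternionic power\<close>

definition unit_vec :: "hqr \<Rightarrow> hqr" where
  "unit_vec q = (1 / vnorm q) *\<^sub>R q"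

lemma unit_vec_squares:
  assumes "vnorm q \<noteq> 0"
  shows "(unit_vec q $ 1)\<^sup>2 + (unit_vec q $ 2)\<^sup>2 + (unit_vec q $ 3)\<^sup>2 = 1"
proof -
  have "(unit_vec q $ 1)\<^sup>2 + (unit_vec q $ 2)\<^sup>2 + (unit_vec q $ 3)\<^sup>2
      = ((q$1)\<^sup>2 + (q$2)\<^sup>2 + (q$3)\<^sup>2) / (vnorm q)\<^sup>2"
    by (simp add: unit_vec_def power_divide add_divide_distrib)
  also have "(q$1)\<^sup>2 + (q$2)\<^sup>2 + (q$3)\<^sup>2 = (vnorm q)\<^sup>2" by (simp add: vnorm_def)
  finally show ?thesis using assms by simp
qed

text \<open>Euler's formulas express cosine and sine through \<open>E1\<close> and
  \<open>E2\<close>, which become the two eigenvalues up to the factor \<open>s\<close>. At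
  \<open>z = 0\<close> both sides are 0; if \<open>vnorm q = 0\<close>, the quotients by it are 0 on
  both sides.\<close>

lemma qpow_qdiag:
  "qpow z q = qdiag (unit_vec q) (z powr Complex (Sc q) (vnorm q)) (z powr Complex (Sc q) (- vnorm q))"
proof (cases "z = 0")
  case True
  then show ?thesis by (simp add: qpow_def qdiag_def hqc_eq_iff)
next
  case False
  define n where "n = vnorm q"
  define L where "L = Ln z"
  define s where "s = z powr complex_of_real (Sc q)"
  define E1 where "E1 = exp (\<i> * (complex_of_real n * L))"
  define E2 where "E2 = exp (\<i> * (complex_of_real (- n) * L))"
  have p: "z powr Complex (Sc q) n = s * E1" "z powr Complex (Sc q) (- n) = s * E2"
    using False by (simp_all add: s_def E1_def E2_def L_def powr_def Complex_eq exp_add[symmetric] algebra_simps)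
  have C: "cos (complex_of_real n * L) = (E1 + E2) / 2"
    by (simp add: cos_exp_eq E1_def E2_def)
  have S: "sin (complex_of_real n * L) = (E1 - E2) / (2 * \<i>)"
    by (simp add: sin_exp_eq E1_def E2_def)
  have "qpow z q = cscale s (hq (cos (complex_of_real n * L))
      (sin (complex_of_real n * L) * complex_of_real (q$1 / n))
      (sin (complex_of_real n * L) * complex_of_real (q$2 / n))
      (sin (complex_of_real n * L) * complex_of_real (q$3 / n)))"
    using False by (simp add: qpow_def Let_def flip: s_def n_def L_def)
  also have "\<dots> = qdiag (unit_vec q) (s * E1) (s * E2)"
    unfolding C S qdiag_def Let_def hqc_eq_iff cscale_nth hq_nth
    by (simp add: unit_vec_def ring_distribs flip: n_def)
  finally show ?thesis using p by (simp add: n_def)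
qed

text \<open>The scalar result in each coordinate; the squared norm is the sum over the coordinates,
  and so is the bound.\<close>

lemma vector_cardinal_series_remainder:
  fixes a :: "int \<Rightarrow> complex ^ 'n" and F :: "real \<Rightarrow> complex ^ 'n"
  assumes g: "decaying g \<sigma> D" and l: "decaying l \<sigma> D'"
    and lg: "\<And>\<xi>. l \<xi> * periodization g \<xi> = g \<xi>"
    and a: "(\<lambda>k. (norm (a k))\<^sup>2) summable_on UNIV"
    and lim: "\<And>x. (\<lambda>N. \<Sum>k\<in>{- int N..int N}. inv_fourier g (x - of_int k) *s a k) \<longlonglongrightarrow> F x"
  obtains \<rho> where "\<rho> \<longlonglongrightarrow> 0"
    "\<And>t N K. finite K \<Longrightarrow> (\<Sum>m\<in>K. (norm (F (t + of_int m) -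
        (\<Sum>k\<in>{- int N..int N}. inv_fourier l (t + of_int m - of_int k) *s F (of_int k))))\<^sup>2) \<le> \<rho> N"
proof -
  define R where "R = (\<lambda>j \<rho>. \<rho> \<longlonglongrightarrow> 0 \<and> (\<forall>t N K. finite K \<longrightarrow> (\<Sum>m\<in>K. (cmod (F (t + of_int m) $ j -
      (\<Sum>k\<in>{- int N..int N}. F (of_int k) $ j * inv_fourier l (t + of_int m - of_int k))))\<^sup>2) \<le> \<rho> N))"
  have "\<exists>\<rho>. R j \<rho>" for j
  proof -
    have "(\<lambda>k. (cmod (a k $ j))\<^sup>2) summable_on UNIV"
      by (rule summable_on_comparison_test[OF a]) (auto intro: power_mono Finite_Cartesian_Product.norm_nth_le)
    moreover have "(\<lambda>N. \<Sum>k\<in>{- int N..int N}. a k $ j * inv_fourier g (x - of_int k)) \<longlonglongrightarrow> F x $ j" for x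
      using tendsto_vec_nth[OF lim[of x], of j] by (simp add: mult.commute)
    ultimately show ?thesis unfolding R_def by (rule cardinal_series_remainder[OF g l lg]) blast
  qed
  then obtain \<rho> where \<rho>: "\<And>j. R j (\<rho> j)" by metis
  show ?thesis
  proof (rule that)
    show "(\<lambda>N. \<Sum>j\<in>UNIV. \<rho> j N) \<longlonglongrightarrow> 0" using \<rho> by (intro tendsto_null_sum) (simp add: R_def)
    fix t N and K :: "int set" assume K: "finite K"
    have nsq: "(norm x)\<^sup>2 = (\<Sum>j\<in>UNIV. (cmod (x $ j))\<^sup>2)" for x :: "complex ^ 'n"
      by (simp add: norm_vec_def L2_set_def sum_nonneg)
    show "(\<Sum>m\<in>K. (norm (F (t + of_int m) -
        (\<Sum>k\<in>{- int N..int N}. inv_fourier l (t + of_int m - of_int k) *s F (of_int k))))\<^sup>2) \<le> (\<Sum>j\<in>UNIV. \<rho> j N)"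
      unfolding nsq using \<rho> K
      by (subst sum.swap) (auto intro!: sum_mono simp: R_def mult.commute[of "inv_fourier l _"])
  qed
qed

lemma cscale_eq_smult: "cscale c x = c *s x"
  by (simp add: cscale_def vector_scalar_mult_def)

lemma qdiag_zero_right: "qdiag u a 0 = cscale a (qdiag u 1 0)"
  and qdiag_zero_left: "qdiag u 0 b = cscale b (qdiag u 0 1)"
  by (simp_all add: qdiag_def hqc_eq_iff Let_def)

text \<open>\<open>qdiag\<close> is complex linear in its pair of eigenvalues, so the integral is
  taken separately on the two idempotents.\<close>

lemma inverse_fourier_qdiag:
  assumes g: "decaying g \<sigma> D" and h: "decaying h \<tau> E"
  shows "cscale (complex_of_real (1 / (2 * pi)))
      (integral UNIV (\<lambda>\<xi>. cscale (exp (\<i> * complex_of_real (\<xi> * x))) (qdiag u (g \<xi>) (h \<xi>))))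
    = qdiag u (inv_fourier g x) (inv_fourier h x)"
proof -
  have "((\<lambda>\<xi>. cscale (g \<xi> * cis (\<xi> * x)) (qdiag u 1 0) + cscale (h \<xi> * cis (\<xi> * x)) (qdiag u 0 1)) has_integral
     cscale (integral UNIV (\<lambda>\<xi>. g \<xi> * cis (\<xi> * x))) (qdiag u 1 0)
     + cscale (integral UNIV (\<lambda>\<xi>. h \<xi> * cis (\<xi> * x))) (qdiag u 0 1)) UNIV"
    using has_integral_linear[OF integrable_integral[OF inv_fourier_integrable[OF g, of x]] bounded_linear_cscale_left]
      has_integral_linear[OF integrable_integral[OF inv_fourier_integrable[OF h, of x]] bounded_linear_cscale_left]
    by (intro has_integral_add) (simp_all add: o_def)
  also have "(\<lambda>\<xi>. cscale (g \<xi> * cis (\<xi> * x)) (qdiag u 1 0) + cscale (h \<xi> * cis (\<xi> * x)) (qdiag u 0 1))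
    = (\<lambda>\<xi>. cscale (exp (\<i> * complex_of_real (\<xi> * x))) (qdiag u (g \<xi>) (h \<xi>)))"
    by (subst qdiag_decompose[of u "g _"])
       (simp add: cscale_add_right cscale_cscale cis_conv_exp mult.commute)
  finally show ?thesis
    unfolding inv_fourier_def
    by (subst qdiag_decompose) (simp add: integral_unique cscale_add_right cscale_cscale)
qed

lemma norm_qmult_le: "\<exists>C. \<forall>a. norm (qmult a b) \<le> norm a * C"
  using bounded_linear.bounded[OF bounded_linear_qmult_left] .

lemma summable_on_norm_qmult:
  assumes "(\<lambda>k. (norm (a k))\<^sup>2) summable_on UNIV"
  shows "(\<lambda>k. (norm (qmult (a k) b))\<^sup>2) summable_on UNIV"
proof -
  obtain C where "\<And>a. norm (qmult a b) \<le> norm a * C" using norm_qmult_le by blast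
  then have "(norm (qmult (a k) b))\<^sup>2 \<le> (norm (a k))\<^sup>2 * C\<^sup>2" for k
    by (metis norm_ge_zero power_mono power_mult_distrib)
  with summable_on_cmult_left[OF assms] show ?thesis
    by (rule summable_on_comparison_test) auto
qed

text \<open>A bound on sums over cosets of the integers, uniform in \<open>t\<close>, controls the
  integral over the line by cutting it into unit intervals, and each single value by taking
  \<open>K = {0}\<close>.\<close>

lemma uniform_remainder_convergence:
  fixes f :: "real \<Rightarrow> 'a::real_normed_vector" and S :: "nat \<Rightarrow> real \<Rightarrow> 'a"
  assumes \<rho>: "\<rho> \<longlonglongrightarrow> 0"
    and le: "\<And>t N K. finite K \<Longrightarrow> (\<Sum>m\<in>K. (norm (f (t + of_int m) - S N (t + of_int m)))\<^sup>2) \<le> \<rho> N"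
  shows "(\<lambda>N. \<integral>\<^sup>+ t. ennreal ((norm (f t - S N t))\<^sup>2) \<partial>lborel) \<longlonglongrightarrow> 0"
    and "uniform_limit X S f sequentially"
proof -
  have "(\<integral>\<^sup>+ t. ennreal ((norm (f t - S N t))\<^sup>2) \<partial>lborel) \<le> ennreal (\<rho> N)" for N
    using le by (intro nn_integral_le_fiber_sums) (simp add: sum_ennreal ennreal_leI)
  then have upper: "\<forall>\<^sub>F N in sequentially.
      (\<integral>\<^sup>+ t. ennreal ((norm (f t - S N t))\<^sup>2) \<partial>lborel) \<le> ennreal (\<rho> N)"
    by (simp add: always_eventually)
  have "(\<lambda>N. ennreal (\<rho> N)) \<longlonglongrightarrow> 0" using tendsto_ennrealI[OF \<rho>] by simp
  from tendsto_sandwich[OF _ upper tendsto_const this]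
  show "(\<lambda>N. \<integral>\<^sup>+ t. ennreal ((norm (f t - S N t))\<^sup>2) \<partial>lborel) \<longlonglongrightarrow> 0"
    by simp
  show "uniform_limit X S f sequentially"
  proof (rule uniform_limitI)
    fix \<epsilon> :: real assume "\<epsilon> > 0"
    then have "\<forall>\<^sub>F N in sequentially. \<rho> N < \<epsilon>\<^sup>2" using \<rho> by (intro order_tendstoD) auto
    then show "\<forall>\<^sub>F N in sequentially. \<forall>t\<in>X. dist (S N t) (f t) < \<epsilon>"
    proof eventually_elim
      case (elim N)
      show ?case
      proof
        fix t
        have "(norm (f t - S N t))\<^sup>2 < \<epsilon>\<^sup>2" using le[of "{0}" t N] elim by simp
        then have "norm (f t - S N t) < \<epsilon>" by (rule power2_less_imp_less) (use \<open>\<epsilon> > 0\<close> in simp)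
        then show "dist (S N t) (f t) < \<epsilon>" by (simp add: dist_norm norm_minus_commute)
      qed
    qed
  qed
qed

lemma norm_add_squared_le:
  fixes x y :: "'a::real_normed_vector"
  shows "(norm (x + y))\<^sup>2 \<le> 2 * (norm x)\<^sup>2 + 2 * (norm y)\<^sup>2"
  using power_mono[OF norm_triangle_ineq[of x y], of 2] sum_squares_bound[of "norm x" "norm y"]
  by (simp add: power2_sum)

section \<open>Reconstruction of quaternionic splines from two scalar components\<close>

context
  fixes q :: hqr and g h :: "real \<Rightarrow> complex" and \<sigma> D E :: real
  assumes q: "vnorm q \<noteq> 0"
    and g: "decaying g \<sigma> D" and h: "decaying h \<sigma> E"
    and g_nz: "\<And>\<xi>. periodization g \<xi> \<noteq> 0" and h_nz: "\<And>\<xi>. periodization h \<xi> \<noteq> 0"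
    and BqHat: "\<And>\<xi>. BqHat q \<xi> = qdiag (unit_vec q) (g \<xi>) (h \<xi>)"
begin

lemma Per_qdiag: "Per q \<xi> = qdiag (unit_vec q) (periodization g \<xi>) (periodization h \<xi>)"
proof -
  let ?u = "unit_vec q"
  have "((\<lambda>k::int. cscale (g (\<xi> + 2 * pi * of_int k)) (qdiag ?u 1 0) + cscale (h (\<xi> + 2 * pi * of_int k)) (qdiag ?u 0 1))
    has_sum cscale (periodization g \<xi>) (qdiag ?u 1 0) + cscale (periodization h \<xi>) (qdiag ?u 0 1)) UNIV"
    unfolding periodization_def
    using decaying.summable_shift[OF g] decaying.summable_shift[OF h]
    by (intro has_sum_add has_sum_bounded_linear[OF bounded_linear_cscale_left, unfolded o_def]) auto
  then show ?thesis
    unfolding Per_def BqHat by (simp only: flip: qdiag_decompose) (rule infsumI)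
qed

lemma Bspl_qdiag: "Bspl q x = qdiag (unit_vec q) (inv_fourier g x) (inv_fourier h x)"
  unfolding Bspl_def BqHat by (rule inverse_fourier_qdiag[OF g h])

text \<open>The coefficients multiply from the left, so the idempotents are applied from the right:
  the spline times \<open>P\<close> is a complex scalar times \<open>P\<close>. This leaves a scalar
  spline with vector coefficients \<open>qmult (a k) P\<close>, and likewise for
  \<open>Q\<close>.\<close>

lemma cardinal_reconstruction:
  assumes f: "in_Hq q f"
  obtains \<rho> where "\<rho> \<longlonglongrightarrow> 0"
    "\<And>t N K. finite K \<Longrightarrow>
      (\<Sum>m\<in>K. (norm (f (t + of_int m) - cardinal_partial q f N (t + of_int m)))\<^sup>2) \<le> \<rho> N"
proof -
  let ?u = "unit_vec q"
  note u = unit_vec_squares[OF q]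
  define lg where "lg = (\<lambda>\<xi>. g \<xi> / periodization g \<xi>)"
  define lh where "lh = (\<lambda>\<xi>. h \<xi> / periodization h \<xi>)"
  obtain D' where lg: "decaying lg \<sigma> D'" using decaying_divide_periodization[OF g g_nz] unfolding lg_def .
  obtain E' where lh: "decaying lh \<sigma> E'" using decaying_divide_periodization[OF h h_nz] unfolding lh_def .
  have Lq: "Lq q x = qdiag ?u (inv_fourier lg x) (inv_fourier lh x)" for x
    unfolding Lq_def BqHat Per_qdiag
    using inverse_fourier_qdiag[OF lg lh, of x ?u] g_nz h_nz
    by (simp add: qinv_qdiag[OF u] qmult_qdiag[OF u] lg_def lh_def)
  obtain a where a: "(\<lambda>k. (norm (a k))\<^sup>2) summable_on UNIV"
    and lim: "\<And>x. (\<lambda>N::nat. \<Sum>k\<in>{- int N..int N}. qmult (a k) (Bspl q (x - of_int k))) \<longlonglongrightarrow> f x"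
    using f unfolding in_Hq_def by blast
  define P Q where "P = qdiag ?u 1 0" and "Q = qdiag ?u 0 1"
  have proj: "(\<lambda>N. \<Sum>k\<in>{- int N..int N}. qmult (qmult (a k) (Bspl q (x - of_int k))) T) \<longlonglongrightarrow> qmult (f x) T" for x T
    using bounded_linear.tendsto[OF bounded_linear_qmult_left lim]
    by (simp only: bounded_linear.linear[OF bounded_linear_qmult_left, THEN linear_sum])
  have limP: "(\<lambda>N. \<Sum>k\<in>{- int N..int N}. inv_fourier g (x - of_int k) *s qmult (a k) P) \<longlonglongrightarrow> qmult (f x) P" for x
    using proj[of x P]
    by (simp add: P_def qmult_assoc Bspl_qdiag qmult_qdiag[OF u] qdiag_zero_right[of _ "inv_fourier _ _"]
        qmult_cscale_right flip: cscale_eq_smult)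
  have limQ: "(\<lambda>N. \<Sum>k\<in>{- int N..int N}. inv_fourier h (x - of_int k) *s qmult (a k) Q) \<longlonglongrightarrow> qmult (f x) Q" for x
    using proj[of x Q]
    by (simp add: Q_def qmult_assoc Bspl_qdiag qmult_qdiag[OF u] qdiag_zero_left[of _ "inv_fourier _ _"]
        qmult_cscale_right flip: cscale_eq_smult)
  define RP where "RP = (\<lambda>N x. qmult (f x) P - (\<Sum>k\<in>{- int N..int N}. inv_fourier lg (x - of_int k) *s qmult (f (of_int k)) P))"
  define RQ where "RQ = (\<lambda>N x. qmult (f x) Q - (\<Sum>k\<in>{- int N..int N}. inv_fourier lh (x - of_int k) *s qmult (f (of_int k)) Q))"
  have lgg: "lg \<xi> * periodization g \<xi> = g \<xi>" for \<xi> using g_nz by (simp add: lg_def)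
  have lhh: "lh \<xi> * periodization h \<xi> = h \<xi>" for \<xi> using h_nz by (simp add: lh_def)
  obtain \<rho>1 where \<rho>1: "\<rho>1 \<longlonglongrightarrow> 0"
    "\<And>t N K. finite K \<Longrightarrow> (\<Sum>m\<in>K. (norm (RP N (t + of_int m)))\<^sup>2) \<le> \<rho>1 N"
    unfolding RP_def
    using vector_cardinal_series_remainder[OF g lg lgg summable_on_norm_qmult[OF a] limP] by blast
  obtain \<rho>2 where \<rho>2: "\<rho>2 \<longlonglongrightarrow> 0"
    "\<And>t N K. finite K \<Longrightarrow> (\<Sum>m\<in>K. (norm (RQ N (t + of_int m)))\<^sup>2) \<le> \<rho>2 N"
    unfolding RQ_def
    using vector_cardinal_series_remainder[OF h lh lhh summable_on_norm_qmult[OF a] limQ] by blast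
  \<comment> \<open>The idempotents \<open>P\<close> and \<open>Q\<close> add up to 1, so the two
    remainders recombine to the remainder of \<open>f\<close>.\<close>
  have split: "x = qmult x P + qmult x Q" for x
  proof -
    have "qdiag ?u 1 1 = P + Q"
      using qdiag_decompose[of ?u 1 1] by (simp add: P_def Q_def cscale_eq_smult)
    then show ?thesis by (metis qdiag_one qmult_add_right)
  qed
  have "cardinal_partial q f N x = (\<Sum>k\<in>{- int N..int N}. inv_fourier lg (x - of_int k) *s qmult (f (of_int k)) P)
      + (\<Sum>k\<in>{- int N..int N}. inv_fourier lh (x - of_int k) *s qmult (f (of_int k)) Q)" for N x
    unfolding cardinal_partial_def Lq qdiag_decompose[of ?u "inv_fourier _ _"] P_def[symmetric] Q_def[symmetric]
    by (simp add: qmult_add_right qmult_cscale_right sum.distrib flip: cscale_eq_smult)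
  then have R: "f x - cardinal_partial q f N x = RP N x + RQ N x" for N x
    using split[of "f x"] by (simp add: RP_def RQ_def)
  show ?thesis
  proof (rule that)
    show "(\<lambda>N. 2 * \<rho>1 N + 2 * \<rho>2 N) \<longlonglongrightarrow> 0"
      using tendsto_add[OF tendsto_mult_right_zero[OF \<rho>1(1)] tendsto_mult_right_zero[OF \<rho>2(1)]] by simp
    fix t N and K :: "int set" assume K: "finite K"
    have "(\<Sum>m\<in>K. (norm (f (t + of_int m) - cardinal_partial q f N (t + of_int m)))\<^sup>2)
      \<le> (\<Sum>m\<in>K. 2 * (norm (RP N (t + of_int m)))\<^sup>2 + 2 * (norm (RQ N (t + of_int m)))\<^sup>2)"
      unfolding R by (intro sum_mono norm_add_squared_le)
    also have "\<dots> \<le> 2 * \<rho>1 N + 2 * \<rho>2 N"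
      using \<rho>1(2)[OF K, of N t] \<rho>2(2)[OF K, of N t] by (simp add: sum.distrib flip: sum_distrib_left)
    finally show "(\<Sum>m\<in>K. (norm (f (t + of_int m) - cardinal_partial q f N (t + of_int m)))\<^sup>2) \<le> 2 * \<rho>1 N + 2 * \<rho>2 N" .
  qed
qed

end

theorem mainTheorem14:
  fixes R :: "complex set" and q :: hqr and f :: "real \<Rightarrow> hqc"
  assumes "R \<subseteq> {w. Re w > 1}"
    and "cnj ` R = R"
    and "\<forall>w\<in>R. \<forall>\<alpha>::real. 0 < \<alpha> \<and> \<alpha> < 1 \<longrightarrow>
           hurwitz_zeta w \<alpha> + exp (- \<i> * of_real pi * w) * hurwitz_zeta w (1 - \<alpha>) \<noteq> 0"
    and "q \<in> QR R"
    and "in_Hq q f"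
  shows "(\<lambda>N. \<integral>\<^sup>+ t. ennreal ((norm (f t - cardinal_partial q f N t))^2) \<partial>lborel) \<longlonglongrightarrow> 0
       \<and> (\<forall>t. (\<lambda>N. cardinal_partial q f N t) \<longlonglongrightarrow> f t)
       \<and> (\<forall>K. compact K \<longrightarrow> uniform_limit K (cardinal_partial q f) f sequentially)"
proof -
  define w where "w = Complex (Sc q) (vnorm q)"
  have wR: "w \<in> R" and q: "vnorm q \<noteq> 0" using assms(4) by (auto simp: QR_def w_def)
  have "cnj w = Complex (Sc q) (- vnorm q)" by (simp add: w_def complex_eq_iff)
  then have BqHat: "BqHat q \<xi> = qdiag (unit_vec q) (Xi \<xi> powr w) (Xi \<xi> powr cnj w)" for \<xi>
    by (simp add: BqHat_def qpow_qdiag w_def)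
  \<comment> \<open>The second eigenvalue has the conjugate exponent; closure of \<open>R\<close>
    under conjugation gives it the zeta condition too.\<close>
  have cR: "cnj w \<in> R" using assms(2) wR by blast
  have Re: "Re w > 1" using assms(1) wR by blast
  have nz: "periodization (\<lambda>\<xi>. Xi \<xi> powr z) \<xi> \<noteq> 0" if "z \<in> R" for z \<xi>
    using that assms(1,3) by (intro periodization_Xi_powr_nonzero) auto
  have dec: "decaying (\<lambda>\<xi>. Xi \<xi> powr cnj w) (Re w) (3 powr Re w * exp (pi * \<bar>Im w\<bar>))"
    using decaying_Xi_powr[of "cnj w"] Re by simp
  obtain \<rho> where \<rho>: "\<rho> \<longlonglongrightarrow> 0"
    "\<And>t N K. finite K \<Longrightarrow>
      (\<Sum>m\<in>K. (norm (f (t + of_int m) - cardinal_partial q f N (t + of_int m)))\<^sup>2) \<le> \<rho> N"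
    using cardinal_reconstruction[OF q decaying_Xi_powr[OF Re] dec nz[OF wR] nz[OF cR] BqHat assms(5)] by blast
  note conv = uniform_remainder_convergence[OF \<rho>]
  have "(\<lambda>N. cardinal_partial q f N t) \<longlonglongrightarrow> f t" for t
    using conv(2)[of "{t}"] by simp
  with conv show ?thesis by blast
qed

end
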